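(* Let $n,\ell\ge1$ be integers. At $q=\rho_\ell=e^{2\pi i/(2\ell+1)}$, the partition function $\mathcal Z_{n,\ell}(\bm x,\bm y)$, viewed as a function of $\bm z=(z_1,\dots,z_{2n})=(x_1,\dots,x_n,y_1,\dots,y_n)$, satisfies the $(\ell,2)_{\rho_\ell^2,\rho_\ell}$-wheel condition.
   Context: Partition function. Let $\bm x=(x_1,\dots,x_n)$, $\bm y=(y_1,\dots,y_n)$, and $\Delta(u_1,\dots,u_m)=\prod_{1\le i<j\le m}(u_i-u_j)$. Put $\bar{\bm x}=(x_1,q^2x_1,\dots,q^{2\ell-2}x_1,\dots,x_n,q^2x_n,\dots,q^{2\ell-2}x_n)$ and define $\bar{\bm y}$ similarly. Let $$\mathcal Z_{n,\ell}(\bm x,\bm y)=\frac{\prod_{i,j=1}^n\prod_{p=0}^{\ell}\prod_{k=0}^{\ell-1}(q^{2k}x_i-q^{2p-1}y_j)}{\Delta(\bar{\bm x})\Delta(\bar{\bm y})}\det\mathcal A_\ell(\bm x,\bm y),$$ where $\mathcal A_\ell(\bm x,\bm y)=[A_\ell(x_\alpha,y_\beta)]_{\alpha,\beta=1}^n$ is the $\ell n\times\ell n$ block matrix with $\ell\times\ell$ blocks $$A_\ell(x,y)=\left[\frac{1}{(q^{2j}x-q^{2i-1}y)(q^{2j}x-q^{2i+1}y)}\right]_{i,j=0}^{\ell-1}.$$ This rational function is a polynomial in $\bm x,\bm y$. Wheel condition. Let $q,t$ be scalars with $q^{r-1}t^{k+1}=1$ for non-negative integers $k,r$. A function $f(z_1,\dots,z_{2n})$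 obeys the $(r,k)_{q,t}$-wheel condition if $f(\bm z)=0$ whenever there are indices $1\le i_1<i_2<\dots<i_{k+1}\le 2n$ and integers $s_1,\dots,s_k\ge0$ with $\sum_{\alpha=1}^k s_\alpha\le r-1$ such that $z_{i_{\alpha+1}}/z_{i_\alpha}=t\,q^{s_\alpha}$ for $\alpha=1,\dots,k$. Thus the $(\ell,2)_{\rho_\ell^2,\rho_\ell}$-wheel condition concerns triples $i_1<i_2<i_3$ with $z_{i_2}=\rho_\ell^{1+2s_1}z_{i_1}$, $z_{i_3}=\rho_\ell^{1+2s_2}z_{i_2}$, $s_1,s_2\ge0$, $s_1+s_2\le\ell-1$. *)

theory Defs
  imports Complex_Main "Jordan_Normal_Form.Determinant"
begin

text \<open>
  All families of variables are indexed from 0: a tuple of length \<open>m\<close> is a function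
  on \<open>nat\<close> of which only the values at \<open>0, \<dots>, m - 1\<close> matter.
\<close>

definition vandermonde :: "nat \<Rightarrow> (nat \<Rightarrow> complex) \<Rightarrow> complex" where
  "vandermonde m u = (\<Prod>j<m. \<Prod>i<j. u i - u j)"

text \<open>
  The sequence \<open>x\<^sub>0, q\<^sup>2 x\<^sub>0, \<dots>, q\<^bsup>2\<ell>-2\<^esup> x\<^sub>0, x\<^sub>1, q\<^sup>2 x\<^sub>1, \<dots>\<close>.
\<close>

definition q_string :: "nat \<Rightarrow> complex \<Rightarrow> (nat \<Rightarrow> complex) \<Rightarrow> nat \<Rightarrow> complex" where
  "q_string l q x a = q ^ (2 * (a mod l)) * x (a div l)"

definition block_denom :: "complex \<Rightarrow> complex \<Rightarrow> complex \<Rightarrow> nat \<Rightarrow> nat \<Rightarrow> complex" where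
  "block_denom q x y i j =
     (q ^ (2 * j) * x - q powi (2 * int i - 1) * y) *
     (q ^ (2 * j) * x - q powi (2 * int i + 1) * y)"

definition A_block :: "nat \<Rightarrow> complex \<Rightarrow> complex \<Rightarrow> complex \<Rightarrow> complex mat" where
  "A_block l q x y = mat l l (\<lambda>(i, j). 1 / block_denom q x y i j)"

definition A_matrix ::
  "nat \<Rightarrow> nat \<Rightarrow> complex \<Rightarrow> (nat \<Rightarrow> complex) \<Rightarrow> (nat \<Rightarrow> complex) \<Rightarrow> complex mat" where
  "A_matrix n l q x y =
     mat (l * n) (l * n)
       (\<lambda>(a, b). A_block l q (x (a div l)) (y (b div l)) $$ (a mod l, b mod l))"

text \<open>
  The formula for the partition function. It is meaningful only where no denominator
  vanishes; elsewhere its value is an artefact of division by zero.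
\<close>

definition partition_formula ::
  "nat \<Rightarrow> nat \<Rightarrow> complex \<Rightarrow> (nat \<Rightarrow> complex) \<Rightarrow> (nat \<Rightarrow> complex) \<Rightarrow> complex" where
  "partition_formula n l q x y =
     (\<Prod>i<n. \<Prod>j<n. \<Prod>p\<le>l. \<Prod>k<l. q ^ (2 * k) * x i - q powi (2 * int p - 1) * y j) /
     (vandermonde (l * n) (q_string l q x) * vandermonde (l * n) (q_string l q y)) *
     det (A_matrix n l q x y)"

definition partition_regular ::
  "nat \<Rightarrow> nat \<Rightarrow> complex \<Rightarrow> (nat \<Rightarrow> complex) \<Rightarrow> (nat \<Rightarrow> complex) \<Rightarrow> bool" where
  "partition_regular n l q x y \<longleftrightarrow>
     vandermonde (l * n) (q_string l q x) \<noteq> 0 \<and>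
     vandermonde (l * n) (q_string l q y) \<noteq> 0 \<and>
     (\<forall>\<alpha><n. \<forall>\<beta><n. \<forall>i<l. \<forall>j<l. block_denom q (x \<alpha>) (y \<beta>) i j \<noteq> 0)"

definition polynomial_fun :: "nat \<Rightarrow> ((nat \<Rightarrow> complex) \<Rightarrow> complex) \<Rightarrow> bool" where
  "polynomial_fun m f \<longleftrightarrow>
     (\<exists>(E :: (nat \<Rightarrow> nat) set) c.
        finite E \<and> f = (\<lambda>z. \<Sum>e\<in>E. c e * (\<Prod>i<m. z i ^ e i)))"

text \<open>
  The partition function as a function of \<open>z = (x\<^sub>0, \<dots>, x\<^bsub>n-1\<^esub>, y\<^sub>0, \<dots>, y\<^bsub>n-1\<^esub>)\<close>: the
  rational function above is a polynomial, and its value at an arbitrary point, including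
  the points where the formula reads \<open>0/0\<close>, is the value of that polynomial. The polynomial
  is determined by its values at the regular points whenever these are dense, that is,
  whenever no denominator vanishes identically; for \<open>q\<close> a primitive root of unity
  of order \<open>2\<ell> + 1\<close> this is the case.
\<close>

definition partition_function :: "nat \<Rightarrow> nat \<Rightarrow> complex \<Rightarrow> (nat \<Rightarrow> complex) \<Rightarrow> complex" where
  "partition_function n l q =
     (THE f. polynomial_fun (2 * n) f \<and>
        (\<forall>z. partition_regular n l q z (\<lambda>j. z (n + j)) \<longrightarrow>
             f z = partition_formula n l q z (\<lambda>j. z (n + j))))"

text \<open>
  The \<open>(r, k)\<^bsub>q,t\<^esub>\<close>-wheel condition for a function of \<open>m\<close> variables. The resonance
  relation between \<open>q\<close> and \<open>t\<close>, under which alone the notion is considered, is part of the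
  predicate. Points with some \<open>z (i \<alpha>) = 0\<close> are excluded by the quotients when \<open>q\<close> and \<open>t\<close>
  are nonzero.
\<close>

definition wheel_condition ::
  "nat \<Rightarrow> nat \<Rightarrow> nat \<Rightarrow> complex \<Rightarrow> complex \<Rightarrow> ((nat \<Rightarrow> complex) \<Rightarrow> complex) \<Rightarrow> bool" where
  "wheel_condition m r k q t f \<longleftrightarrow>
     q powi (int r - 1) * t ^ (k + 1) = 1 \<and>
     (\<forall>z (i :: nat \<Rightarrow> nat) (s :: nat \<Rightarrow> nat).
        strict_mono_on {..k} i \<and> (\<forall>\<alpha>\<le>k. i \<alpha> < m) \<and>
        int (\<Sum>\<alpha><k. s \<alpha>) \<le> int r - 1 \<and>
        (\<forall>\<alpha><k. z (i (\<alpha> + 1)) / z (i \<alpha>) = t * q ^ s \<alpha>)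
        \<longrightarrow> f z = 0)"

definition rho :: "nat \<Rightarrow> complex" where
  "rho l = exp (2 * of_real pi * \<i> / of_nat (2 * l + 1))"

end

theory Submission
  imports Defs "HOL-Computational_Algebra.Polynomial"
begin

text \<open>
  The theorem holds because at \<open>q = \<rho>\<^sub>l\<close> the partition function is a constant multiple of
  a Schur polynomial in the \<open>2 l n\<close> variables \<open>q\<^bsup>2k\<^esup> z\<^sub>i\<close>, \<open>0 \<le> k < l\<close>. It is the Schur polynomial
  whose alternant has the exponents below \<open>(2l+1) n\<close> that are not congruent to \<open>2l\<close> modulo
  \<open>2l+1\<close>; the corresponding partition has the parts \<open>n-1, \<dots>, 1, 0\<close>, each repeated \<open>2l\<close> times.

  The wheel condition for the Schur polynomial. Put \<open>w = q\<^sup>2\<close>, a primitive root of unity of order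
  \<open>2l+1\<close>, so that \<open>q = w\<^bsup>l+1\<^esup>\<close>. At a wheel point the three strings \<open>w\<^sup>k z\<^sub>i\<close>, \<open>k < l\<close>, that belong to
  the three variables may overlap, but together they run through all \<open>2l+1\<close> multiples \<open>w\<^sup>r \<zeta>\<close> of
  one number \<open>\<zeta> \<noteq> 0\<close>. Since \<open>\<Sum>\<^sub>r w\<^sup>r (w\<^sup>r \<zeta>)\<^sup>e = 0\<close> for every exponent \<open>e\<close> that occurs, the rows
  of the alternant at these points are linearly dependent. As the Vandermonde determinant may vanish
  there too, the quotient is written as a determinant of Newton interpolation coefficients, in
  which the dependency survives coinciding nodes (\<open>schur_det_eq_0\<close>, \<open>schur_wheel\<close>).

  The comparison with the partition function. Multiplying the rows of the matrix of the partition
  function by common denominators and splitting off a matrix that is constant up to powers of the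
  \<open>y\<^sub>\<beta>\<close> leaves a determinant of polynomials
  \<open>X\<^sup>j \<Prod>\<^sub>\<gamma> \<Prod>\<^sub>p (X - w\<^bsup>p+l\<^esup> y\<^sub>\<gamma>)\<close>, \<open>\<gamma> \<noteq> \<beta>\<close>, evaluated at the points \<open>X\<close> of the \<open>x\<close>-strings
  (\<open>det_cleared\<close>). The identity
  \<open>\<Prod>\<^sub>p (X - w\<^bsup>p+l\<^esup> y) \<Prod>\<^sub>e (X - w\<^sup>e y) = X\<^bsup>2l+1\<^esup> - y\<^bsup>2l+1\<^esup>\<close>, with \<open>p \<le> l\<close> and \<open>e < l\<close>,
  shows that these polynomials, multiplied by \<open>\<Prod>(X - Y)\<close> over all points \<open>Y\<close> of the \<open>y\<close>-strings,
  are combinations of the monomials in the alternant, and for generic \<open>y\<close> they span those that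
  vanish at all \<open>Y\<close>. A change of basis therefore makes the alternant block triangular, and the Schur polynomial appears
  (\<open>det_vanishing_blocks\<close>, \<open>schur_determinant_identity\<close>).

  This comparison also proves that the rational expression for the partition function extends to a
  polynomial, so that \<open>partition_function\<close> is that polynomial: the extension exists, and it is
  unique because the regular points are the complement of the zeros of a nonzero polynomial
  (\<open>polynomial_fun_eqI\<close>).
\<close>


section \<open>Polynomial functions of finitely many variables\<close>

lemma polynomial_fun_const: "polynomial_fun m (\<lambda>z. c)"
  unfolding polynomial_fun_def
  by (rule exI[of _ "{\<lambda>_. 0}"], rule exI[of _ "\<lambda>_. c"]) simp

lemma polynomial_fun_var:
  assumes "i < m"
  shows "polynomial_fun m (\<lambda>z. z i)"
proof -
  have "(\<Prod>j<m. z j ^ (if j = i then 1 else 0)) = z i" for z :: "nat \<Rightarrow> complex"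
  proof -
    have "(\<Prod>j<m. z j ^ (if j = i then 1 else 0)) = (\<Prod>j<m. if j = i then z j else 1)"
      by (intro prod.cong) auto
    then show ?thesis using assms by (simp add: prod.delta)
  qed
  then show ?thesis
    unfolding polynomial_fun_def
    by (intro exI[of _ "{\<lambda>j. if j = i then 1 else 0}"] exI[of _ "\<lambda>_. 1"]) simp
qed

lemma polynomial_fun_add:
  assumes "polynomial_fun m f" "polynomial_fun m g"
  shows "polynomial_fun m (\<lambda>z. f z + g z)"
proof -
  obtain E c where E: "finite E" "f = (\<lambda>z. \<Sum>e\<in>E. c e * (\<Prod>i<m. z i ^ e i))"
    using assms(1) unfolding polynomial_fun_def by blast
  obtain F d where F: "finite F" "g = (\<lambda>z. \<Sum>e\<in>F. d e * (\<Prod>i<m. z i ^ e i))"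
    using assms(2) unfolding polynomial_fun_def by blast
  define c' where "c' e = (if e \<in> E then c e else 0) + (if e \<in> F then d e else 0)" for e
  have "f z + g z = (\<Sum>e\<in>E \<union> F. c' e * (\<Prod>i<m. z i ^ e i))" for z
  proof -
    have "f z = (\<Sum>e\<in>E \<union> F. (if e \<in> E then c e else 0) * (\<Prod>i<m. z i ^ e i))"
      unfolding E(2) using E(1) F(1) by (intro sum.mono_neutral_cong_left) auto
    moreover have "g z = (\<Sum>e\<in>E \<union> F. (if e \<in> F then d e else 0) * (\<Prod>i<m. z i ^ e i))"
      unfolding F(2) using E(1) F(1) by (intro sum.mono_neutral_cong_left) auto
    ultimately show ?thesis
      unfolding c'_def by (simp add: sum.distrib distrib_right)
  qed
  then show ?thesis
    unfolding polynomial_fun_def using E(1) F(1) by (intro exI[of _ "E \<union> F"] exI[of _ c']) auto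
qed

lemma polynomial_fun_sum:
  assumes "\<And>i. i \<in> I \<Longrightarrow> polynomial_fun m (f i)"
  shows "polynomial_fun m (\<lambda>z. \<Sum>i\<in>I. f i z)"
  using assms
  by (induction I rule: infinite_finite_induct)
     (auto intro: polynomial_fun_const polynomial_fun_add)

lemma polynomial_fun_monom_mult:
  assumes "polynomial_fun m g"
  shows "polynomial_fun m (\<lambda>z. a * (\<Prod>i<m. z i ^ e i) * g z)"
proof -
  obtain F d where F: "finite F" "g = (\<lambda>z. \<Sum>f\<in>F. d f * (\<Prod>i<m. z i ^ f i))"
    using assms unfolding polynomial_fun_def by blast
  define s where "s f i = e i + f i" for f :: "nat \<Rightarrow> nat" and i
  have inj: "inj_on s F"
    by (intro inj_onI) (auto simp: s_def fun_eq_iff)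
  have "a * (\<Prod>i<m. z i ^ e i) * g z
      = (\<Sum>h\<in>s ` F. a * d (\<lambda>i. h i - e i) * (\<Prod>i<m. z i ^ h i))" for z
    unfolding F(2) sum.reindex[OF inj]
    by (simp add: s_def sum_distrib_left power_add prod.distrib algebra_simps)
  then show ?thesis
    unfolding polynomial_fun_def using F(1)
    by (intro exI[of _ "s ` F"] exI[of _ "\<lambda>h. a * d (\<lambda>i. h i - e i)"]) auto
qed

lemma polynomial_fun_mult:
  assumes "polynomial_fun m f" "polynomial_fun m g"
  shows "polynomial_fun m (\<lambda>z. f z * g z)"
proof -
  obtain E c where E: "finite E" "f = (\<lambda>z. \<Sum>e\<in>E. c e * (\<Prod>i<m. z i ^ e i))"
    using assms(1) unfolding polynomial_fun_def by blast
  have "polynomial_fun m (\<lambda>z. \<Sum>e\<in>E. c e * (\<Prod>i<m. z i ^ e i) * g z)"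
    by (intro polynomial_fun_sum polynomial_fun_monom_mult assms(2))
  then show ?thesis unfolding E(2) by (simp add: sum_distrib_right)
qed

lemma polynomial_fun_diff:
  assumes "polynomial_fun m f" "polynomial_fun m g"
  shows "polynomial_fun m (\<lambda>z. f z - g z)"
  using polynomial_fun_add[OF assms(1) polynomial_fun_mult[OF polynomial_fun_const[of m "-1"] assms(2)]]
  by simp

lemma polynomial_fun_prod:
  assumes "\<And>i. i \<in> I \<Longrightarrow> polynomial_fun m (f i)"
  shows "polynomial_fun m (\<lambda>z. \<Prod>i\<in>I. f i z)"
  using assms
  by (induction I rule: infinite_finite_induct)
     (auto intro: polynomial_fun_const polynomial_fun_mult)

lemma polynomial_fun_power:
  assumes "polynomial_fun m f"
  shows "polynomial_fun m (\<lambda>z. f z ^ e)"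
  by (induction e) (auto intro: polynomial_fun_const polynomial_fun_mult assms)

lemma polynomial_fun_line:
  assumes "polynomial_fun m f"
  shows "\<exists>p. \<forall>t. f (\<lambda>i. a i + t * b i) = poly p t"
proof -
  obtain E c where E: "finite E" "f = (\<lambda>z. \<Sum>e\<in>E. c e * (\<Prod>i<m. z i ^ e i))"
    using assms(1) unfolding polynomial_fun_def by blast
  have "f (\<lambda>i. a i + t * b i) = poly (\<Sum>e\<in>E. [:c e:] * (\<Prod>i<m. [:a i, b i:] ^ e i)) t" for t
    unfolding E(2)
    by (simp only: poly_sum poly_prod poly_mult poly_power poly_pCons poly_0 mult_zero_right
        add_0_right)
  then show ?thesis by (intro exI allI)
qed

text \<open>
  Restriction to the complex line through a given point and a point where \<open>g\<close> does not vanish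
  reduces this to the fact that univariate polynomials form a domain. It stands in for density
  arguments: an identity that holds wherever \<open>g\<close> does not vanish holds everywhere.
\<close>

lemma polynomial_fun_cancel:
  assumes "polynomial_fun m f" "polynomial_fun m g"
    and "\<And>z. f z * g z = 0" and "g z0 \<noteq> 0"
  shows "f z = 0"
proof -
  obtain p where p: "\<And>t. f (\<lambda>i. z i + t * (z0 i - z i)) = poly p t"
    using polynomial_fun_line[OF assms(1), where a = z and b = "\<lambda>i. z0 i - z i"] by (rule exE) (iprover)
  obtain r where r: "\<And>t. g (\<lambda>i. z i + t * (z0 i - z i)) = poly r t"
    using polynomial_fun_line[OF assms(2), where a = z and b = "\<lambda>i. z0 i - z i"] by (rule exE) (iprover)
  have "poly (p * r) t = 0" for t
    using assms(3)[of "\<lambda>i. z i + t * (z0 i - z i)"] unfolding p r poly_mult .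
  then have "\<forall>t. poly (p * r) t = 0" by (rule allI)
  then have "p * r = 0" by (rule iffD1[OF poly_all_0_iff_0])
  moreover have "poly r 1 = g z0" by (simp add: r[of 1, symmetric])
  then have "r \<noteq> 0" using assms(4) by auto
  ultimately have "p = 0" by simp
  moreover have "f z = poly p 0" by (simp add: p[of 0, symmetric])
  ultimately show ?thesis by simp
qed

section \<open>Determinants of matrices given by their entries\<close>

definition detf :: "nat \<Rightarrow> (nat \<Rightarrow> nat \<Rightarrow> complex) \<Rightarrow> complex" where
  "detf N f = det (mat N N (\<lambda>(a, b). f a b))"

lemma detf_cong:
  assumes "\<And>a b. a < N \<Longrightarrow> b < N \<Longrightarrow> f a b = g a b"
  shows "detf N f = detf N g"
  unfolding detf_def using assms by (intro arg_cong[where f = det] eq_matI) auto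

lemma detf_mult:
  assumes "\<And>a c. a < N \<Longrightarrow> c < N \<Longrightarrow> h a c = (\<Sum>b<N. f a b * g b c)"
  shows "detf N h = detf N f * detf N g"
proof -
  have "mat N N (\<lambda>(a, b). h a b) = mat N N (\<lambda>(a, b). f a b) * mat N N (\<lambda>(a, b). g a b)"
    by (rule eq_matI) (auto simp: assms scalar_prod_def atLeast0LessThan)
  then show ?thesis unfolding detf_def by (simp add: det_mult[of _ N])
qed

lemma detf_transpose: "detf N (\<lambda>a b. f b a) = detf N f"
proof -
  have "mat N N (\<lambda>(a, b). f b a) = transpose_mat (mat N N (\<lambda>(a, b). f a b))"
    by (rule eq_matI) auto
  then show ?thesis unfolding detf_def by (simp add: det_transpose[of _ N])
qed

lemma detf_upper_triangular:
  assumes "\<And>a b. b < a \<Longrightarrow> a < N \<Longrightarrow> f a b = 0"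
  shows "detf N f = (\<Prod>a<N. f a a)"
proof -
  have "det (mat N N (\<lambda>(a, b). f a b)) = prod_list (diag_mat (mat N N (\<lambda>(a, b). f a b)))"
    using assms by (intro det_upper_triangular[of _ N]) auto
  also have "\<dots> = (\<Prod>a = 0..<N. f a a)"
    unfolding prod_list_diag_prod by simp
  finally show ?thesis by (simp add: detf_def atLeast0LessThan)
qed

lemma detf_lower_triangular:
  assumes "\<And>a b. a < b \<Longrightarrow> b < N \<Longrightarrow> f a b = 0"
  shows "detf N f = (\<Prod>a<N. f a a)"
  using detf_upper_triangular[of N "\<lambda>a b. f b a"] assms detf_transpose[of N f] by simp

lemma detf_scale_rows: "detf N (\<lambda>a b. s a * f a b) = (\<Prod>a<N. s a) * detf N f"
proof -
  have "detf N (\<lambda>a b. s a * f a b) = detf N (\<lambda>a b. if a = b then s a else 0) * detf N f"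
    by (rule detf_mult) (simp add: if_distrib[of "\<lambda>x. x * _"] sum.delta cong: if_cong)
  then show ?thesis by (simp add: detf_upper_triangular)
qed

lemma detf_scale_cols: "detf N (\<lambda>a b. f a b * s b) = detf N f * (\<Prod>a<N. s a)"
  using detf_scale_rows[of N s "\<lambda>a b. f b a"] detf_transpose[of N "\<lambda>a b. f a b * s b"]
    detf_transpose[of N f]
  by (simp add: mult.commute)

text \<open>
  The sign is the same for all matrices, which is all that matters here: constant factors are not
  tracked.
\<close>

lemma detf_permute_rows:
  assumes "bij_betw \<pi> {..<N} {..<N}"
  obtains s :: complex where "s * s = 1" "\<And>f. detf N (\<lambda>a b. f (\<pi> a) b) = s * detf N f"
proof -
  define p where "p a = (if a < N then \<pi> a else a)" for a
  have p: "p permutes {0..<N}"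
  proof (rule bij_imp_permutes)
    have "bij_betw p {..<N} {..<N} \<longleftrightarrow> bij_betw \<pi> {..<N} {..<N}"
      by (rule bij_betw_cong) (simp add: p_def)
    then show "bij_betw p {0..<N} {0..<N}"
      using assms by (simp add: atLeast0LessThan)
  qed (auto simp: p_def)
  have "detf N (\<lambda>a b. f (\<pi> a) b) = signof p * detf N f" for f
  proof -
    have "mat N N (\<lambda>(a, b). f (\<pi> a) b)
        = mat N N (\<lambda>(i, j). mat N N (\<lambda>(a, b). f a b) $$ (p i, j))"
      using bij_betwE[OF assms] by (intro eq_matI) (auto simp: p_def)
    then show ?thesis
      unfolding detf_def by (simp add: det_permute_rows[OF _ p])
  qed
  moreover have "signof p * signof p = (1 :: complex)"
    using signof_pm_one[of p] by (auto simp: sign_def)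
  ultimately show ?thesis by (rule that[rotated])
qed

lemma detf_permute_both:
  assumes "bij_betw \<pi> {..<N} {..<N}"
  shows "detf N (\<lambda>a b. f (\<pi> a) (\<pi> b)) = detf N f"
proof -
  obtain s where s: "s * s = 1" "\<And>f. detf N (\<lambda>a b. f (\<pi> a) b) = s * detf N f"
    using detf_permute_rows[OF assms] by blast
  have "detf N (\<lambda>a b. f (\<pi> a) (\<pi> b)) = s * detf N (\<lambda>a b. f a (\<pi> b))"
    by (rule s(2))
  also have "detf N (\<lambda>a b. f a (\<pi> b)) = detf N (\<lambda>a b. f b (\<pi> a))"
    by (rule detf_transpose[symmetric])
  also have "\<dots> = s * detf N (\<lambda>a b. f b a)" by (rule s(2))
  also have "detf N (\<lambda>a b. f b a) = detf N f" by (rule detf_transpose)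
  finally show ?thesis using s(1) by (simp add: mult.assoc[symmetric])
qed

lemma detf_block_lower_triangular:
  assumes "\<And>a b. a < p \<Longrightarrow> p \<le> b \<Longrightarrow> b < p + q \<Longrightarrow> f a b = 0"
  shows "detf (p + q) f = detf p f * detf q (\<lambda>a b. f (p + a) (p + b))"
proof -
  have "mat (p + q) (p + q) (\<lambda>(a, b). f a b)
      = four_block_mat (mat p p (\<lambda>(a, b). f a b)) (0\<^sub>m p q)
          (mat q p (\<lambda>(a, b). f (p + a) b)) (mat q q (\<lambda>(a, b). f (p + a) (p + b)))"
    using assms by (intro eq_matI) auto
  then show ?thesis
    unfolding detf_def by (simp add: det_four_block_mat_upper_right_zero[of _ p _ q])
qed

lemma detf_block_diagonal:
  "detf (r * n) (\<lambda>a b. if a div n = b div n then f (a div n) (a mod n) (b mod n) else 0)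
     = (\<Prod>i<r. detf n (f i))"
proof (cases "n = 0")
  case True
  then show ?thesis by (simp add: detf_def)
next
  case False
  show ?thesis
  proof (induction r)
    case 0
    then show ?case by (simp add: detf_def)
  next
    case (Suc r)
    let ?g = "\<lambda>a b. if a div n = b div n then f (a div n) (a mod n) (b mod n) else 0"
    have "detf (Suc r * n) ?g = detf (r * n + n) ?g" by (simp add: add.commute)
    also have "\<dots> = detf (r * n) ?g * detf n (\<lambda>a b. ?g (r * n + a) (r * n + b))"
    proof (rule detf_block_lower_triangular)
      fix a b assume "a < r * n" "r * n \<le> b"
      then have "a div n < r" "r \<le> b div n"
        using False div_le_mono[of "r * n" b n] by (auto simp: less_mult_imp_div_less)
      then show "?g a b = 0" by auto
    qed
    also have "detf n (\<lambda>a b. ?g (r * n + a) (r * n + b)) = detf n (f r)"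
      by (rule detf_cong) auto
    finally show ?case using Suc.IH by simp
  qed
qed

lemma polynomial_fun_detf:
  assumes "\<And>a b. a < N \<Longrightarrow> b < N \<Longrightarrow> polynomial_fun m (\<lambda>z. f z a b)"
  shows "polynomial_fun m (\<lambda>z. detf N (f z))"
proof -
  have "detf N (f z) = (\<Sum>p\<in>{p. p permutes {0..<N}}. signof p * (\<Prod>i = 0..<N. f z i (p i)))" for z
    unfolding detf_def
    by (subst det_def', rule mat_carrier)
       (auto intro!: sum.cong prod.cong arg_cong2[where f = "(*)"] simp: permutes_in_image)
  moreover have "polynomial_fun m
      (\<lambda>z. \<Sum>p\<in>{p. p permutes {0..<N}}. signof p * (\<Prod>i = 0..<N. f z i (p i)))"
    by (intro polynomial_fun_sum polynomial_fun_mult polynomial_fun_const polynomial_fun_prod assms)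
       (auto simp: permutes_in_image)
  ultimately show ?thesis by simp
qed

section \<open>Newton interpolation and alternants\<close>

text \<open>
  The coefficient of \<open>X\<^sup>e\<close> at \<open>\<Prod>\<^sub>i\<^sub><\<^sub>k (X - Z\<^sub>i)\<close>, that is, the complete homogeneous symmetric
  polynomial of degree \<open>e - k\<close> in \<open>Z\<^sub>0, \<dots>, Z\<^sub>k\<close>. The recursion comes from
  \<open>X N\<^sub>k = N\<^sub>k\<^sub>+\<^sub>1 + Z\<^sub>k N\<^sub>k\<close> for the Newton polynomials \<open>N\<^sub>k\<close>.
\<close>

fun newton_coeff :: "(nat \<Rightarrow> complex) \<Rightarrow> nat \<Rightarrow> nat \<Rightarrow> complex" where
  "newton_coeff Z 0 k = (if k = 0 then 1 else 0)"
| "newton_coeff Z (Suc e) k =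
     Z k * newton_coeff Z e k + (if k = 0 then 0 else newton_coeff Z e (k - 1))"

lemma newton_coeff_eq_0: "e < k \<Longrightarrow> newton_coeff Z e k = 0"
  by (induction e arbitrary: k) auto

lemma newton_coeff_diag: "newton_coeff Z e e = 1"
  by (induction e) (auto simp: newton_coeff_eq_0)

lemma newton_expansion:
  assumes "e \<le> K"
  shows "X ^ e = (\<Sum>k\<le>K. newton_coeff Z e k * (\<Prod>i<k. X - Z i))"
  using assms
proof (induction e)
  case 0
  have "(\<Sum>k\<le>K. newton_coeff Z 0 k * (\<Prod>i<k. X - Z i)) = (\<Sum>k\<le>K. if k = 0 then 1 else 0)"
    by (intro sum.cong) auto
  then show ?case by simp
next
  case (Suc e)
  then obtain K' where K: "K = Suc K'" by (cases K) auto
  define N where "N k = (\<Prod>i<k. X - Z i)" for k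
  have N: "X * N k = N (Suc k) + Z k * N k" for k
    by (simp add: N_def algebra_simps)
  have "X ^ Suc e = (\<Sum>k\<le>K. newton_coeff Z e k * (X * N k))"
    using Suc by (simp add: N_def sum_distrib_left algebra_simps)
  also have "\<dots> = (\<Sum>k\<le>K. newton_coeff Z e k * N (Suc k))
      + (\<Sum>k\<le>K. Z k * newton_coeff Z e k * N k)"
    by (simp add: N sum.distrib algebra_simps)
  also have "(\<Sum>k\<le>K. newton_coeff Z e k * N (Suc k)) = (\<Sum>k\<le>K'. newton_coeff Z e k * N (Suc k))"
    using Suc.prems by (simp add: K newton_coeff_eq_0)
  also have "\<dots> = (\<Sum>k\<le>K. (if k = 0 then 0 else newton_coeff Z e (k - 1)) * N k)"
    unfolding K by (subst sum.atMost_Suc_shift) simp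
  finally show ?case
    by (simp add: N_def sum.distrib algebra_simps del: prod.lessThan_Suc)
qed

text \<open>
  At a node the expansion may be cut off at the number of nodes, whatever the exponent, because
  all later Newton polynomials vanish there.
\<close>

lemma newton_expansion_node:
  assumes "a < M"
  shows "Z a ^ e = (\<Sum>k<M. (\<Prod>i<k. Z a - Z i) * newton_coeff Z e k)"
proof -
  have "Z a ^ e = (\<Sum>k\<le>e + M. newton_coeff Z e k * (\<Prod>i<k. Z a - Z i))"
    by (rule newton_expansion) simp
  also have "\<dots> = (\<Sum>k<M. newton_coeff Z e k * (\<Prod>i<k. Z a - Z i))"
  proof (intro sum.mono_neutral_right ballI)
    fix k assume "k \<in> {..e + M} - {..<M}"
    then have "(\<Prod>i<k. Z a - Z i) = 0"
      using assms by (intro prod_zero) auto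
    then show "newton_coeff Z e k * (\<Prod>i<k. Z a - Z i) = 0" by simp
  qed auto
  finally show ?thesis by (simp add: mult.commute)
qed

text \<open>
  The quotient of the alternant with the given exponents by the Vandermonde product, in a form that
  needs no division: a Schur polynomial, up to the sign that comes from the order of the exponents.
\<close>

definition schur_det :: "nat \<Rightarrow> (nat \<Rightarrow> nat) \<Rightarrow> (nat \<Rightarrow> complex) \<Rightarrow> complex" where
  "schur_det M ex Z = detf M (\<lambda>k b. newton_coeff Z (ex b) k)"

text \<open>
  The opposite sign convention to \<open>vandermonde\<close> is the one in which Newton polynomials at their
  nodes appear.
\<close>

definition vander :: "nat \<Rightarrow> (nat \<Rightarrow> complex) \<Rightarrow> complex" where
  "vander M Z = (\<Prod>a<M. \<Prod>i<a. Z a - Z i)"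

text \<open>
  Newton expansion at the nodes factorizes the alternant, and the Newton polynomials at the nodes
  form a lower triangular matrix.
\<close>

lemma alternant_factorization:
  "detf M (\<lambda>a b. Z a ^ ex b) = vander M Z * schur_det M ex Z"
proof -
  have "detf M (\<lambda>a b. Z a ^ ex b)
      = detf M (\<lambda>a k. \<Prod>i<k. Z a - Z i) * detf M (\<lambda>k b. newton_coeff Z (ex b) k)"
    by (rule detf_mult) (rule newton_expansion_node)
  also have "detf M (\<lambda>a k. \<Prod>i<k. Z a - Z i) = (\<Prod>a<M. \<Prod>i<a. Z a - Z i)"
    by (rule detf_lower_triangular) (auto intro!: prod_zero)
  finally show ?thesis by (simp add: vander_def schur_det_def)
qed

lemma vander_eq_detf: "detf M (\<lambda>a b. Z a ^ b) = vander M Z"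
proof -
  have "schur_det M (\<lambda>b. b) Z = 1"
    unfolding schur_det_def
    by (subst detf_upper_triangular) (auto simp: newton_coeff_eq_0 newton_coeff_diag)
  then show ?thesis using alternant_factorization[of M Z "\<lambda>b. b"] by simp
qed

lemma vander_nonzero:
  assumes "inj_on Z {..<M}"
  shows "vander M Z \<noteq> 0"
  using assms unfolding vander_def by (auto dest!: inj_onD)

lemma vandermonde_eq_vander: "vandermonde M u = (\<Prod>a<M. \<Prod>i<a. -1) * vander M u"
proof -
  have "vandermonde M u = (\<Prod>a<M. \<Prod>i<a. -1 * (u a - u i))"
    unfolding vandermonde_def by simp
  then show ?thesis unfolding vander_def prod.distrib .
qed

text \<open>
  If the nodes were distinct, a linear relation between rows of the alternant would make it vanish,
  and the Vandermonde product could be cancelled. The Newton form works for coinciding nodes too: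
  the relation between the rows at the \<open>\<zeta> r\<close> yields a vector \<open>v\<close> that annihilates the matrix of
  Newton coefficients. It is nonzero: of the points \<open>\<zeta> r\<close>, take the one whose first occurrence among
  the nodes comes last, at position \<open>k\<close> say; then the Newton polynomial \<open>N\<^sub>k\<close> vanishes at all the
  other \<open>\<zeta> r\<close>, but not at this one.
\<close>

lemma schur_det_eq_0:
  fixes \<zeta> :: "nat \<Rightarrow> complex" and L :: nat
  assumes \<zeta>: "\<And>r. r < L \<Longrightarrow> \<exists>a<M. Z a = \<zeta> r"
    and inj: "inj_on \<zeta> {..<L}"
    and L: "L > 0"
    and coeff: "\<And>r. r < L \<Longrightarrow> c r \<noteq> 0"
    and rel: "\<And>b. b < M \<Longrightarrow> (\<Sum>r<L. c r * \<zeta> r ^ ex b) = 0"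
  shows "schur_det M ex Z = 0"
proof -
  define fst_occ where "fst_occ r = (LEAST a. a < M \<and> Z a = \<zeta> r)" for r
  have occ: "fst_occ r < M" "Z (fst_occ r) = \<zeta> r" if "r < L" for r
    using LeastI_ex[OF \<zeta>[OF that]] unfolding fst_occ_def by blast+
  have before: "Z i \<noteq> \<zeta> r" if "r < L" "i < fst_occ r" for r i
    using not_less_Least[of i "\<lambda>a. a < M \<and> Z a = \<zeta> r"] that occ(1)[OF that(1)]
    unfolding fst_occ_def by auto
  have "finite (fst_occ ` {..<L})" "fst_occ ` {..<L} \<noteq> {}" using L by auto
  from Max_in[OF this] obtain R where R: "R < L" "fst_occ R = Max (fst_occ ` {..<L})" by auto
  have le: "fst_occ r \<le> fst_occ R" if "r < L" for r using that R(2) by simp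
  define v where "v k = (\<Sum>r<L. c r * (\<Prod>i<k. \<zeta> r - Z i))" for k
  have zero: "(\<Prod>i<fst_occ R. \<zeta> r - Z i) = 0" if "r < L" "r \<noteq> R" for r
  proof -
    have "fst_occ r \<noteq> fst_occ R"
      using occ(2)[OF that(1)] occ(2)[OF R(1)] inj that R(1) by (metis inj_onD lessThan_iff)
    then show ?thesis using le[OF that(1)] occ(2)[OF that(1)]
      by (intro prod_zero) (auto intro!: bexI[of _ "fst_occ r"])
  qed
  have "(\<Sum>r\<in>{..<L} - {R}. c r * (\<Prod>i<fst_occ R. \<zeta> r - Z i)) = 0"
    by (intro sum.neutral ballI) (use zero in auto)
  then have "v (fst_occ R) = c R * (\<Prod>i<fst_occ R. \<zeta> R - Z i)"
    unfolding v_def using R(1) by (subst sum.remove[of _ R]) auto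
  also have "\<dots> \<noteq> 0"
    using coeff[OF R(1)] before[OF R(1)] by force
  finally have v: "v (fst_occ R) \<noteq> 0" .
  define A where "A = mat M M (\<lambda>(b, k). newton_coeff Z (ex b) k)"
  have "A *\<^sub>v vec M v = 0\<^sub>v M"
  proof (rule eq_vecI)
    fix b assume "b < dim_vec (0\<^sub>v M)"
    then have b: "b < M" by simp
    have "(A *\<^sub>v vec M v) $ b = (\<Sum>k<M. newton_coeff Z (ex b) k * v k)"
      using b by (simp add: A_def scalar_prod_def atLeast0LessThan)
    also have "\<dots> = (\<Sum>r<L. c r * (\<Sum>k<M. (\<Prod>i<k. \<zeta> r - Z i) * newton_coeff Z (ex b) k))"
      unfolding v_def sum_distrib_left by (subst sum.swap) (simp add: algebra_simps)
    also have "\<dots> = (\<Sum>r<L. c r * \<zeta> r ^ ex b)"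
    proof (intro sum.cong refl)
      fix r assume "r \<in> {..<L}"
      then have r: "r < L" by simp
      show "c r * (\<Sum>k<M. (\<Prod>i<k. \<zeta> r - Z i) * newton_coeff Z (ex b) k) = c r * \<zeta> r ^ ex b"
        using newton_expansion_node[OF occ(1)[OF r], of Z "ex b"] by (simp add: occ(2)[OF r])
    qed
    finally show "(A *\<^sub>v vec M v) $ b = 0\<^sub>v M $ b" using rel[OF b] b by simp
  qed (simp add: A_def)
  moreover have "vec M v \<noteq> 0\<^sub>v M"
    using v occ(1)[OF R(1)] by (metis index_vec index_zero_vec(1))
  moreover have "A \<in> carrier_mat M M" by (simp add: A_def)
  ultimately have "det A = 0"
    by (subst det_0_iff_vec_prod_zero_field) (auto intro!: exI[of _ "vec M v"])
  then have "detf M (\<lambda>b k. newton_coeff Z (ex b) k) = 0" by (simp add: detf_def A_def)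
  then show ?thesis
    unfolding schur_det_def using detf_transpose[of M "\<lambda>k b. newton_coeff Z (ex b) k"] by simp
qed

lemma polynomial_fun_newton_coeff:
  assumes "\<And>a. a \<le> k \<Longrightarrow> polynomial_fun m (\<lambda>z. Z z a)"
  shows "polynomial_fun m (\<lambda>z. newton_coeff (Z z) e k)"
  using assms
proof (induction e arbitrary: k)
  case 0
  then show ?case by (simp add: polynomial_fun_const)
next
  case (Suc e)
  then show ?case
    by (cases "k = 0") (auto intro!: polynomial_fun_add polynomial_fun_mult)
qed

section \<open>Pairs of indices as single indices\<close>

lemma bij_betw_pair_index:
  "bij_betw (\<lambda>(i, j). i * n + j) ({..<r} \<times> {..<n}) {..<r * n :: nat}"
proof (rule bij_betwI[where g = "\<lambda>a. (a div n, a mod n)"])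
  show "(\<lambda>(i, j). i * n + j) \<in> {..<r} \<times> {..<n} \<rightarrow> {..<r * n}"
  proof clarsimp
    fix i j assume "i < r" "j < n"
    then have "i * n + j < Suc i * n" by simp
    moreover have "Suc i * n \<le> r * n" using \<open>i < r\<close> by (intro mult_le_mono1) simp
    ultimately show "i * n + j < r * n" by linarith
  qed
qed (auto simp: less_mult_imp_div_less intro!: mod_less_divisor Nat.gr0I)

lemma sum_pair_index: "(\<Sum>a<r * n. f (a div n) (a mod n)) = (\<Sum>i<r. \<Sum>j<n. f i j)" for r n :: nat
  unfolding sum.cartesian_product
  by (rule sum.reindex_bij_betw[OF bij_betw_pair_index, symmetric, THEN trans])
     (auto intro!: sum.cong)

lemma prod_pair_index: "(\<Prod>a<r * n. f (a div n) (a mod n)) = (\<Prod>i<r. \<Prod>j<n. f i j)" for r n :: nat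
  unfolding prod.cartesian_product
  by (rule prod.reindex_bij_betw[OF bij_betw_pair_index, symmetric, THEN trans])
     (auto intro!: prod.cong)

text \<open>
  The change between the two orders of a doubly indexed family, with a rearrangement \<open>h\<close> of one
  of the two indices.
\<close>

lemma bij_betw_swap_index:
  assumes h: "bij_betw h {..<r} {..<r}"
  shows "bij_betw (\<lambda>a. (a mod n) * r + h (a div n)) {..<r * n} {..<r * n :: nat}"
proof -
  have "bij_betw (\<lambda>a. (a div n, a mod n)) {..<r * n} ({..<r} \<times> {..<n})"
    by (rule bij_betwI[where g = "\<lambda>(i, j). i * n + j"])
       (use bij_betw_pair_index[of n r] in
        \<open>auto simp: less_mult_imp_div_less bij_betw_def intro!: mod_less_divisor Nat.gr0I\<close>)
  moreover have "bij_betw (\<lambda>(i, j). (j, h i)) ({..<r} \<times> {..<n}) ({..<n} \<times> {..<r})"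
    using h bij_betw_imp_surj_on[OF h] by (auto simp: bij_betw_def inj_on_def image_iff) blast
  moreover have "bij_betw (\<lambda>(i, j). i * r + j) ({..<n} \<times> {..<r}) {..<r * n}"
    using bij_betw_pair_index[of r n] by (simp add: mult.commute)
  ultimately have "bij_betw ((\<lambda>(i, j). i * r + j) \<circ> ((\<lambda>(i, j). (j, h i)) \<circ> (\<lambda>a. (a div n, a mod n))))
      {..<r * n} {..<r * n}"
    by (blast intro: bij_betw_trans)
  then show ?thesis by (simp add: o_def)
qed

section \<open>Monic polynomials with given roots\<close>

definition root_poly :: "('i \<Rightarrow> complex) \<Rightarrow> 'i set \<Rightarrow> complex poly" where
  "root_poly f S = (\<Prod>i\<in>S. [:- f i, 1:])"

lemma poly_root_poly: "poly (root_poly f S) X = (\<Prod>i\<in>S. X - f i)"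
  by (simp add: root_poly_def poly_prod)

lemma degree_root_poly: "degree (root_poly f S) = card S"
  unfolding root_poly_def by (subst degree_prod_sum_eq) auto

lemma coeff_root_poly_card: "coeff (root_poly f S) (card S) = 1"
  using lead_coeff_prod[of "\<lambda>i. [:- f i, 1:]" S] degree_root_poly[of f S]
  by (simp add: root_poly_def)

lemma poly_eq_sum_lessThan:
  fixes p :: "complex poly"
  assumes "degree p < m"
  shows "poly p X = (\<Sum>j<m. coeff p j * X ^ j)"
  unfolding poly_altdef using assms
  by (intro sum.mono_neutral_left) (auto simp: coeff_eq_0)

text \<open>
  Homogeneity separates the powers of \<open>y\<close> from coefficients that do not depend on \<open>y\<close>.
\<close>

lemma homogeneous_root_product:
  assumes "finite S"
  shows "(\<Prod>i\<in>S. X - f i * y)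
     = (\<Sum>j<Suc (card S). X ^ j * y ^ (card S - j) * coeff (root_poly f S) j)"
proof (cases "y = 0")
  case True
  have "(\<Sum>j<Suc (card S). X ^ j * y ^ (card S - j) * coeff (root_poly f S) j)
      = (\<Sum>j<Suc (card S). if j = card S then X ^ card S else 0)"
    using True by (intro sum.cong) (auto simp: coeff_root_poly_card)
  then show ?thesis using True by simp
next
  case False
  have "(\<Prod>i\<in>S. X - f i * y) = (\<Prod>i\<in>S. y * (X / y - f i))"
    using False by (simp add: right_diff_distrib mult.commute)
  also have "\<dots> = y ^ card S * poly (root_poly f S) (X / y)"
    by (simp add: prod.distrib poly_root_poly)
  also have "\<dots> = (\<Sum>j<Suc (card S). y ^ card S * (coeff (root_poly f S) j * (X / y) ^ j))"
    by (subst poly_eq_sum_lessThan[of _ "Suc (card S)"])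
       (simp_all add: degree_root_poly sum_distrib_left del: sum.lessThan_Suc)
  also have "\<dots> = (\<Sum>j<Suc (card S). X ^ j * y ^ (card S - j) * coeff (root_poly f S) j)"
    using False by (intro sum.cong) (auto simp: power_diff power_divide)
  finally show ?thesis .
qed

section \<open>Odd roots of unity\<close>

locale odd_primitive_root =
  fixes l :: nat and q :: complex
  assumes l_pos: "l \<ge> 1"
    and q_power_order: "q ^ (2 * l + 1) = 1"
    and q_inj: "inj_on (\<lambda>k. q ^ k) {..<2 * l + 1}"
begin

definition w :: complex where "w = q\<^sup>2"

lemma q_nonzero: "q \<noteq> 0"
  using q_power_order by auto

lemma w_nonzero: "w \<noteq> 0"
  using q_nonzero by (simp add: w_def)

lemma w_power_order: "w ^ (2 * l + 1) = 1"
  using q_power_order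
  by (simp only: w_def power_mult[symmetric] mult.commute[of 2]) (simp only: power_mult power_one)

lemma w_power_half: "w ^ (l + 1) = q"
proof -
  have "w ^ (l + 1) = q ^ (2 * l + 1) * q"
    unfolding w_def power_mult[symmetric] power_Suc2[symmetric] by simp
  then show ?thesis by (simp only: q_power_order mult_1)
qed

lemma w_inj: "inj_on (\<lambda>k. w ^ k) {..<2 * l + 1}"
proof (rule inj_onI)
  fix i j assume ij: "i \<in> {..<2 * l + 1}" "j \<in> {..<2 * l + 1}" "w ^ i = w ^ j"
  have "q ^ k = (w ^ k) ^ (l + 1)" for k
    by (subst w_power_half[symmetric]) (simp only: power_mult[symmetric] mult.commute)
  then have "q ^ i = q ^ j" using ij(3) by simp
  then show "i = j" using q_inj ij by (auto dest: inj_onD)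
qed

lemma norm_w: "norm w = 1"
proof -
  have "norm w ^ (2 * l + 1) = 1" using w_power_order by (metis norm_power norm_one)
  then show ?thesis using power_eq_1_iff[of "norm w" "2 * l + 1"] by auto
qed

lemma w_power_mult_order: "w ^ ((2 * l + 1) * k) = 1"
  by (simp only: power_mult w_power_order power_one)

lemma q_powi_minus: "q powi (2 * int i - 1) = w ^ (i + l)"
proof -
  have "q powi (2 * int i - 1) = q ^ (2 * i) / q"
    using q_nonzero power_int_diff[of q "2 * int i" 1] power_int_of_nat[of q "2 * i"] by simp
  \<comment> \<open>make the exponent even after division by \<open>q\<close>\<close>
  also have "q ^ (2 * i) = q ^ (2 * i + (2 * l + 1))"
    by (simp only: power_add[of q "2 * i"] q_power_order mult_1_right)
  also have "\<dots> / q = w ^ (i + l)"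
    using q_nonzero by (simp add: w_def power_mult[symmetric] power_add)
  finally show ?thesis .
qed

lemma q_powi_plus: "q powi (2 * int i + 1) = w ^ (Suc i + l)"
  using q_powi_minus[of "Suc i"] by (simp add: algebra_simps)

lemma prod_roots: "(\<Prod>e<2 * l + 1. X - w ^ e * y) = X ^ (2 * l + 1) - y ^ (2 * l + 1)"
proof (cases "y = 0")
  case False
  let ?L = "2 * l + 1"
  define p where "p = root_poly (\<lambda>e. w ^ e * y) {..<?L}"
  define r where "r = monom 1 ?L - [:y ^ ?L:]"
  have inj: "inj_on (\<lambda>e. w ^ e * y) {..<?L}"
    using w_inj False by (auto simp: inj_on_def)
  have "p = r"
  proof (rule poly_eqI_degree_lead_coeff[of _ ?L _ "(\<lambda>e. w ^ e * y) ` {..<?L}"])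
    show "coeff p ?L = coeff r ?L"
      using coeff_root_poly_card[of "\<lambda>e. w ^ e * y" "{..<?L}"]
      by (simp add: p_def r_def coeff_pCons split: nat.splits)
    show "card ((\<lambda>e. w ^ e * y) ` {..<?L}) \<ge> ?L" using card_image[OF inj] by simp
    show "degree p \<le> ?L" by (simp add: p_def degree_root_poly)
    show "degree r \<le> ?L" unfolding r_def
      by (intro degree_diff_le degree_monom_le) auto
    fix z assume "z \<in> (\<lambda>e. w ^ e * y) ` {..<?L}"
    then obtain e where e: "e < ?L" "z = w ^ e * y" by auto
    have "poly p z = 0" using e
      by (auto simp: p_def poly_root_poly simp del: lessThan_Suc prod.lessThan_Suc intro!: prod_zero)
    moreover have "z ^ ?L = y ^ ?L"
      unfolding e(2) power_mult_distrib power_mult[symmetric] mult.commute[of e] w_power_mult_order by simp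
    ultimately show "poly p z = poly r z" by (simp add: r_def poly_monom)
  qed
  then have "poly p X = poly r X" by simp
  then show ?thesis by (simp add: p_def r_def poly_root_poly poly_monom del: prod.lessThan_Suc)
qed simp

text \<open>
  The poles in \<open>X\<close> of a block of the partition function lie at \<open>w\<^sup>e y\<close> with \<open>l \<le> e \<le> 2 l\<close>, and the
  string of \<open>y\<close> consists of the \<open>w\<^sup>e y\<close> with \<open>e < l\<close>. That these are complementary sets of roots is
  special to a root of unity of order \<open>2 l + 1\<close>.
\<close>

lemma prod_roots_split:
  "(\<Prod>p\<le>l. X - w ^ (p + l) * y) * (\<Prod>e<l. X - w ^ e * y) = X ^ (2 * l + 1) - y ^ (2 * l + 1)"
proof -
  have split: "{..<2 * l + 1} = {..<l} \<union> {l..<2 * l + 1}" by auto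
  have "(\<Prod>e<2 * l + 1. X - w ^ e * y)
      = (\<Prod>e\<in>{..<l}. X - w ^ e * y) * (\<Prod>e\<in>{l..<2 * l + 1}. X - w ^ e * y)"
    unfolding split by (rule prod.union_disjoint) auto
  also have "(\<Prod>e\<in>{l..<2 * l + 1}. X - w ^ e * y) = (\<Prod>p\<le>l. X - w ^ (p + l) * y)"
    by (rule prod.reindex_bij_witness[of _ "\<lambda>p. p + l" "\<lambda>e. e - l"]) auto
  finally show ?thesis using prod_roots[of X y] by (simp only: mult.commute)
qed

lemma sum_root_powers:
  assumes "\<not> (2 * l + 1) dvd d"
  shows "(\<Sum>r<2 * l + 1. w ^ (r * d)) = 0"
proof -
  let ?L = "2 * l + 1"
  have "w ^ d = w ^ (?L * (d div ?L) + d mod ?L)" by (simp only: mult_div_mod_eq)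
  also have "\<dots> = w ^ (d mod ?L)"
    by (simp only: power_add w_power_mult_order mult_1)
  finally have d: "w ^ d = w ^ (d mod ?L)" .
  have "d mod ?L \<noteq> 0" using assms by (simp add: dvd_eq_mod_eq_0)
  then have "w ^ (d mod ?L) \<noteq> w ^ 0"
    using inj_onD[OF w_inj, of "d mod ?L" 0] by (metis lessThan_iff mod_less_divisor zero_less_Suc Suc_eq_plus1)
  then have "w ^ d \<noteq> 1" using d by simp
  moreover have "(\<Sum>r<?L. w ^ (r * d)) = (\<Sum>r<?L. (w ^ d) ^ r)"
    by (intro sum.cong refl) (simp only: power_mult[symmetric] mult.commute)
  moreover have "(w ^ d) ^ ?L = 1"
    by (simp only: power_mult[symmetric] mult.commute[of d] w_power_mult_order)
  ultimately show ?thesis using geometric_sum[of "w ^ d" ?L] by simp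
qed

lemma vander_roots_nonzero: "vander l (\<lambda>k. w ^ k) \<noteq> 0"
  by (rule vander_nonzero) (rule inj_on_subset[OF w_inj], auto)

end

lemma odd_primitive_root_rho:
  assumes "l \<ge> 1"
  shows "odd_primitive_root l (rho l)"
proof
  have rho: "rho l = cis (2 * pi / real (2 * l + 1))"
    unfolding rho_def cis_conv_exp by (simp add: field_simps)
  have pow: "rho l ^ k = cis (2 * pi * real k / real (2 * l + 1))" for k
    unfolding rho DeMoivre by (simp add: field_simps)
  have bij: "bij_betw (\<lambda>k. cis (2 * pi * real k / real (2 * l + 1))) {..<2 * l + 1}
      {z. z ^ (2 * l + 1) = 1}"
    by (rule bij_betw_roots_unity) simp
  then show "inj_on (\<lambda>k. rho l ^ k) {..<2 * l + 1}"
    unfolding pow by (rule bij_betw_imp_inj_on)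
  have "1 \<in> {..<2 * l + 1}" using assms by simp
  from bij_betwE[OF bij, rule_format, OF this] show "rho l ^ (2 * l + 1) = 1"
    unfolding rho by simp
qed (rule assms)

section \<open>The Schur polynomial of the strings\<close>

locale partition_nodes = odd_primitive_root +
  fixes n :: nat
  assumes n_pos: "n \<ge> 1"
begin

text \<open>
  Points of the strings are numbered \<open>a = k n + j\<close>, with the position \<open>k\<close> in the string first and
  the number \<open>j\<close> of the variable second. In this order a matrix that is triangular in \<open>k\<close> for each \<open>j\<close>
  separately is triangular. In \<open>nodes\<close> the \<open>y\<close>-strings come before the \<open>x\<close>-strings, because the alternant
  is to be split along functions that vanish at all \<open>y\<close>-nodes.
\<close>

definition string :: "(nat \<Rightarrow> complex) \<Rightarrow> nat \<Rightarrow> complex" where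
  "string u a = w ^ (a div n) * u (a mod n)"

definition ys :: "(nat \<Rightarrow> complex) \<Rightarrow> nat \<Rightarrow> complex" where
  "ys z = string (\<lambda>j. z (n + j))"

definition nodes :: "(nat \<Rightarrow> complex) \<Rightarrow> nat \<Rightarrow> complex" where
  "nodes z a = (if a < l * n then ys z a else string z (a - l * n))"

text \<open>
  This enumerates the exponents below \<open>(2 l + 1) n\<close> that are not congruent to \<open>2 l\<close> modulo
  \<open>2 l + 1\<close>, ordered by their residue first.
\<close>

definition exponent :: "nat \<Rightarrow> nat" where
  "exponent b = (2 * l + 1) * (b mod n) + b div n"

definition schur :: "(nat \<Rightarrow> complex) \<Rightarrow> complex" where
  "schur z = schur_det (l * n + l * n) exponent (nodes z)"

lemma polynomial_fun_string:
  assumes "\<And>j. j < n \<Longrightarrow> polynomial_fun m (\<lambda>z. u z j)"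
  shows "polynomial_fun m (\<lambda>z. string (u z) a)"
  unfolding string_def using n_pos
  by (intro polynomial_fun_mult polynomial_fun_const assms) simp

lemma polynomial_fun_xs: "polynomial_fun (2 * n) (\<lambda>z. string z a)"
  by (intro polynomial_fun_string polynomial_fun_var) simp

lemma polynomial_fun_ys: "polynomial_fun (2 * n) (\<lambda>z. ys z a)"
  unfolding ys_def by (intro polynomial_fun_string polynomial_fun_var) simp

lemma polynomial_fun_nodes: "polynomial_fun (2 * n) (\<lambda>z. nodes z a)"
  unfolding nodes_def by (cases "a < l * n") (simp_all add: polynomial_fun_xs polynomial_fun_ys)

lemma polynomial_fun_schur: "polynomial_fun (2 * n) schur"
proof -
  have "polynomial_fun (2 * n) (\<lambda>z. detf (l * n + l * n) (\<lambda>k b. newton_coeff (nodes z) (exponent b) k))"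
    by (intro polynomial_fun_detf polynomial_fun_newton_coeff polynomial_fun_nodes)
  then show ?thesis by (simp add: schur_def[abs_def] schur_det_def)
qed

lemma index_less: "i < r \<Longrightarrow> j < n \<Longrightarrow> i * n + j < r * n" for r :: nat
  using bij_betw_pair_index[of n r] by (auto simp: bij_betw_def)

lemma node_exists:
  assumes "j < 2 * n" "k < l"
  shows "\<exists>a<l * n + l * n. nodes z a = w ^ k * z j"
proof (cases "j < n")
  case True
  then show ?thesis using index_less[OF assms(2) True]
    by (intro exI[of _ "l * n + (k * n + j)"]) (simp add: nodes_def string_def)
next
  case False
  then obtain j' where j': "j = n + j'" "j' < n"
    using assms(1) by (metis add_less_cancel_left le_iff_add linorder_not_less mult_2)
  then show ?thesis using index_less[OF assms(2) j'(2)]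
    by (intro exI[of _ "k * n + j'"]) (simp add: nodes_def string_def ys_def)
qed

text \<open>
  The sum of \<open>w\<^bsup>r (e + 1)\<^esup>\<close> over \<open>r\<close> vanishes unless \<open>2 l + 1\<close> divides \<open>e + 1\<close>, that is, unless \<open>e\<close>
  lies in the residue class left out.
\<close>

lemma sum_root_powers_exponent:
  assumes "b < l * n + l * n"
  shows "(\<Sum>r<2 * l + 1. w ^ r * (w ^ r * \<zeta>) ^ exponent b) = 0"
proof -
  have "b div n < 2 * l" using assms n_pos by (simp add: less_mult_imp_div_less)
  moreover have "Suc (exponent b) = (2 * l + 1) * (b mod n) + Suc (b div n)"
    by (simp add: exponent_def)
  ultimately have "\<not> (2 * l + 1) dvd Suc (exponent b)"
    by (simp only: dvd_add_right_iff[OF dvd_triv_left]) (auto dest: dvd_imp_le)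
  from sum_root_powers[OF this]
  have "(\<Sum>r<2 * l + 1. w ^ (r * Suc (exponent b)) * \<zeta> ^ exponent b) = 0"
    by (simp only: sum_distrib_right[symmetric] mult_zero_left)
  moreover have "w ^ (r * Suc (exponent b)) * \<zeta> ^ exponent b = w ^ r * (w ^ r * \<zeta>) ^ exponent b" for r
    by (simp add: power_mult_distrib power_mult power_add)
  ultimately show ?thesis by simp
qed

text \<open>
  As multiples of the first variable, the strings of the three variables start at
  \<open>w\<^sup>0\<close>, \<open>w\<^bsup>l+1+s\<^sub>0\<^esup>\<close> and \<open>w\<^bsup>1+s\<^sub>0+s\<^sub>1\<^esup>\<close>. In the order first, third, second they leave no gap
  among the exponents \<open>0, \<dots>, 2l\<close>, because \<open>s\<^sub>0 + s\<^sub>1 < l\<close>.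
\<close>

lemma schur_wheel:
  assumes j: "j0 < 2 * n" "j1 < 2 * n" "j2 < 2 * n"
    and s: "s0 + s1 \<le> l - 1"
    and z: "z j0 \<noteq> 0" "z j1 = q * w ^ s0 * z j0" "z j2 = q * w ^ s1 * z j1"
  shows "schur z = 0"
proof -
  have z1: "z j1 = w ^ (l + 1 + s0) * z j0"
    by (simp only: z(2) power_add[of w "l + 1"] w_power_half)
  have "q * q = w" by (simp add: w_def power2_eq_square)
  then have z2: "z j2 = w ^ (1 + s0 + s1) * z j0"
    by (simp add: z(2,3) power_add algebra_simps)
  have cover: "\<exists>a<l * n + l * n. nodes z a = w ^ r * z j0" if r: "r < 2 * l + 1" for r
  proof -
    consider "r < l" | "1 + s0 + s1 \<le> r" "r - (1 + s0 + s1) < l"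
      | "l + 1 + s0 \<le> r" "r - (l + 1 + s0) < l"
      using r s l_pos by linarith
    then show ?thesis
    proof cases
      case 1
      then show ?thesis using node_exists[OF j(1)] by simp
    next
      case 2
      have "w ^ (r - (1 + s0 + s1)) * z j2 = w ^ r * z j0"
        using 2(1) unfolding z2 by (simp only: mult.assoc[symmetric] power_add[symmetric] le_add_diff_inverse2)
      then show ?thesis using node_exists[OF j(3) 2(2), of z] by simp
    next
      case 3
      have "w ^ (r - (l + 1 + s0)) * z j1 = w ^ r * z j0"
        using 3(1) unfolding z1 by (simp only: mult.assoc[symmetric] power_add[symmetric] le_add_diff_inverse2)
      then show ?thesis using node_exists[OF j(2) 3(2), of z] by simp
    qed
  qed
  have inj: "inj_on (\<lambda>r. w ^ r * z j0) {..<2 * l + 1}"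
    using w_inj z(1) by (auto simp: inj_on_def)
  show ?thesis
    unfolding schur_def
    by (rule schur_det_eq_0[OF cover inj, where c = "\<lambda>r. w ^ r"])
       (use w_nonzero sum_root_powers_exponent in simp_all)
qed

section \<open>Evaluation of the alternant\<close>

definition yv :: "(nat \<Rightarrow> complex) \<Rightarrow> nat \<Rightarrow> complex" where
  "yv z j = z (n + j) ^ (2 * l + 1)"

text \<open>
  The Lagrange polynomials, up to normalization, at the points \<open>y\<^sub>j\<^bsup>2l+1\<^esup>\<close>. They are to be taken at
  \<open>X\<^bsup>2l+1\<^esup>\<close>, where \<open>lagrange z j\<close> kills the strings of all \<open>y\<^sub>i\<close> with \<open>i \<noteq> j\<close>.
\<close>

definition lagrange :: "(nat \<Rightarrow> complex) \<Rightarrow> nat \<Rightarrow> complex poly" where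
  "lagrange z j = root_poly (yv z) ({..<n} - {j})"

text \<open>
  For \<open>t = 0, \<dots>, 2 l - 1\<close> a monic basis of the polynomials of degree less than \<open>2 l\<close>, whose second
  half vanishes on the string of \<open>y\<^sub>j\<close>. Times \<open>lagrange z j\<close> at \<open>X\<^bsup>2l+1\<^esup>\<close>, that second half vanishes on
  all \<open>y\<close>-strings.
\<close>

definition vanishing :: "(nat \<Rightarrow> complex) \<Rightarrow> nat \<Rightarrow> nat \<Rightarrow> complex poly" where
  "vanishing z t j = (if t < l then monom 1 t
     else monom 1 (t - l) * root_poly (\<lambda>e. w ^ e * z (n + j)) {..<l})"

definition lag_det :: "(nat \<Rightarrow> complex) \<Rightarrow> complex" where
  "lag_det z = detf n (\<lambda>m j. coeff (lagrange z j) m)"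

definition lag_prod :: "(nat \<Rightarrow> complex) \<Rightarrow> complex" where
  "lag_prod z = (\<Prod>j<n. \<Prod>i\<in>{..<n} - {j}. yv z j - yv z i)"

definition cross :: "(nat \<Rightarrow> complex) \<Rightarrow> complex" where
  "cross z = (\<Prod>a<l * n. \<Prod>b<l * n. string z a - ys z b)"

definition y_weight :: "(nat \<Rightarrow> complex) \<Rightarrow> complex" where
  "y_weight z = (\<Prod>a<l * n. z (n + a mod n) ^ (a div n))"

definition root_det :: complex where
  "root_det = detf (l * n) (\<lambda>a b. if a mod n = b mod n then w ^ ((a div n) * (b div n)) else 0)"

text \<open>
  Clearing the denominators in each row of the matrix of the partition function turns its columns
  into combinations of these polynomials in a point of an \<open>x\<close>-string.
\<close>

definition cleared_entry :: "(nat \<Rightarrow> complex) \<Rightarrow> nat \<Rightarrow> nat \<Rightarrow> complex" where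
  "cleared_entry z a b = string z a ^ (b div n) *
     (\<Prod>j\<in>{..<n} - {b mod n}. \<Prod>p\<le>l. string z a - w ^ (p + l) * z (n + j))"

definition cleared_det :: "(nat \<Rightarrow> complex) \<Rightarrow> complex" where
  "cleared_det z = detf (l * n) (cleared_entry z)"

lemma degree_lagrange: "j < n \<Longrightarrow> degree (lagrange z j) < n"
  unfolding lagrange_def degree_root_poly by (simp add: card_Diff_singleton)

lemma degree_vanishing: "degree (vanishing z t j) = t"
proof (cases "t < l")
  case False
  let ?r = "root_poly (\<lambda>e. w ^ e * z (n + j)) {..<l}"
  have "?r \<noteq> 0" by (simp add: root_poly_def)
  then have "degree (monom 1 (t - l) * ?r) = (t - l) + l"
    by (subst degree_mult_eq) (simp_all add: degree_monom_eq degree_root_poly monom_eq_0_iff)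
  then show ?thesis using False by (simp add: vanishing_def)
qed (simp add: vanishing_def degree_monom_eq)

lemma monic_vanishing: "coeff (vanishing z t j) t = 1"
  unfolding vanishing_def
  using coeff_root_poly_card[of "\<lambda>e. w ^ e * z (n + j)" "{..<l}"]
  by (auto simp: coeff_monom_mult)

lemma mod_n_less: "b mod n < n"
  using n_pos by simp

lemma div_n_less: "b < l * n \<Longrightarrow> b div n < l"
  by (simp add: less_mult_imp_div_less)

text \<open>
  For each residue of the exponents separately, the powers of \<open>X\<^bsup>2l+1\<^esup>\<close> are replaced by the Lagrange
  polynomials: the transition matrix consists of \<open>2 l\<close> equal diagonal blocks.
\<close>

lemma det_lagrange_columns:
  "detf (l * n + l * n)
     (\<lambda>a b. Z a ^ (b div n) * poly (lagrange z (b mod n)) (Z a ^ (2 * l + 1)))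
   = detf (l * n + l * n) (\<lambda>a b. Z a ^ exponent b) * lag_det z ^ (2 * l)"
proof -
  let ?M = "2 * l * n" and ?L = "2 * l + 1"
  have M: "l * n + l * n = ?M" by (simp add: algebra_simps)
  define K where "K b c = (if b div n = c div n then coeff (lagrange z (c mod n)) (b mod n) else 0)" for b c
  have "detf ?M (\<lambda>a b. Z a ^ (b div n) * poly (lagrange z (b mod n)) (Z a ^ ?L))
      = detf ?M (\<lambda>a b. Z a ^ exponent b) * detf ?M K"
  proof (rule detf_mult)
    fix a c assume "c < ?M"
    then have c: "c div n < 2 * l" by (simp add: less_mult_imp_div_less)
    have "(\<Sum>b<?M. Z a ^ exponent b * K b c)
        = (\<Sum>b<?M. (\<lambda>i m. Z a ^ (?L * m + i) *
            (if i = c div n then coeff (lagrange z (c mod n)) m else 0)) (b div n) (b mod n))"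
      by (simp add: exponent_def K_def)
    also have "\<dots> = (\<Sum>i<2 * l. \<Sum>m<n. Z a ^ (?L * m + i) *
            (if i = c div n then coeff (lagrange z (c mod n)) m else 0))"
      by (rule sum_pair_index)
    also have "\<dots> = (\<Sum>i<2 * l. if i = c div n then
        (\<Sum>m<n. Z a ^ (?L * m + i) * coeff (lagrange z (c mod n)) m) else 0)"
      by (intro sum.cong) auto
    also have "\<dots> = (\<Sum>m<n. Z a ^ (?L * m + c div n) * coeff (lagrange z (c mod n)) m)"
      using c by (subst sum.delta) auto
    also have "\<dots> = Z a ^ (c div n) * (\<Sum>m<n. coeff (lagrange z (c mod n)) m * (Z a ^ ?L) ^ m)"
      unfolding sum_distrib_left power_add power_mult by (intro sum.cong) (simp_all add: mult_ac)
    also have "\<dots> = Z a ^ (c div n) * poly (lagrange z (c mod n)) (Z a ^ ?L)"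
      by (simp only: poly_eq_sum_lessThan[OF degree_lagrange[OF mod_n_less]])
    finally show "Z a ^ (c div n) * poly (lagrange z (c mod n)) (Z a ^ ?L)
        = (\<Sum>b<?M. Z a ^ exponent b * K b c)" by simp
  qed
  also have "detf ?M K = lag_det z ^ (2 * l)"
    unfolding K_def lag_det_def
    using detf_block_diagonal[of "2 * l" n "\<lambda>_ m j. coeff (lagrange z j) m"] by simp
  finally show ?thesis unfolding M .
qed

text \<open>
  For each \<open>j\<close> separately, the powers of \<open>X\<close> below \<open>2 l\<close> are replaced by monic polynomials of the same
  degrees: the transition matrix is unitriangular.
\<close>

lemma det_vanishing_columns:
  "detf (l * n + l * n)
     (\<lambda>a b. poly (vanishing z (b div n) (b mod n)) (Z a) *
        poly (lagrange z (b mod n)) (Z a ^ (2 * l + 1)))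
   = detf (l * n + l * n)
       (\<lambda>a b. Z a ^ (b div n) * poly (lagrange z (b mod n)) (Z a ^ (2 * l + 1)))"
proof -
  let ?M = "2 * l * n"
  have M: "l * n + l * n = ?M" by (simp add: algebra_simps)
  define W where "W b c = (if b mod n = c mod n
    then coeff (vanishing z (c div n) (c mod n)) (b div n) else 0)" for b c
  define G where "G a j = poly (lagrange z j) (Z a ^ (2 * l + 1))" for a j
  have "detf ?M (\<lambda>a b. poly (vanishing z (b div n) (b mod n)) (Z a) * G a (b mod n))
      = detf ?M (\<lambda>a b. Z a ^ (b div n) * G a (b mod n)) * detf ?M W"
  proof (rule detf_mult)
    fix a c assume "c < ?M"
    then have c: "c div n < 2 * l" by (simp add: less_mult_imp_div_less)
    let ?p = "vanishing z (c div n) (c mod n)"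
    have "(\<Sum>b<?M. Z a ^ (b div n) * G a (b mod n) * W b c)
        = (\<Sum>b<?M. (\<lambda>i m. Z a ^ i * G a m * (if m = c mod n then coeff ?p i else 0)) (b div n) (b mod n))"
      by (simp add: W_def)
    also have "\<dots> = (\<Sum>i<2 * l. \<Sum>m<n. Z a ^ i * G a m * (if m = c mod n then coeff ?p i else 0))"
      by (rule sum_pair_index)
    also have "\<dots> = (\<Sum>i<2 * l. \<Sum>m<n. if m = c mod n then Z a ^ i * G a m * coeff ?p i else 0)"
      by (intro sum.cong) auto
    also have "\<dots> = (\<Sum>i<2 * l. Z a ^ i * G a (c mod n) * coeff ?p i)"
      using mod_n_less by (subst sum.delta) auto
    also have "\<dots> = poly ?p (Z a) * G a (c mod n)"
      by (subst poly_eq_sum_lessThan[of _ "2 * l"])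
         (use c in \<open>simp_all add: degree_vanishing sum_distrib_left mult_ac\<close>)
    finally show "poly ?p (Z a) * G a (c mod n)
        = (\<Sum>b<?M. Z a ^ (b div n) * G a (b mod n) * W b c)" by simp
  qed
  also have "detf ?M W = (\<Prod>a<?M. W a a)"
  proof (rule detf_upper_triangular)
    fix a b assume ab: "b < a" "a < ?M"
    have "W a b = 0" if "a mod n = b mod n"
    proof -
      have "b div n < a div n"
        using ab(1) that by (metis div_le_mono div_mult_mod_eq le_neq_implies_less less_imp_le nat_neq_iff)
      then show ?thesis using that by (simp add: W_def coeff_eq_0 degree_vanishing)
    qed
    then show "W a b = 0" by (cases "a mod n = b mod n") (simp_all add: W_def)
  qed
  also have "\<dots> = 1" by (simp add: W_def monic_vanishing)
  finally show ?thesis unfolding M G_def by simp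
qed

lemma ys_power: "ys z a ^ (2 * l + 1) = yv z (a mod n)"
  unfolding ys_def string_def yv_def power_mult_distrib power_mult[symmetric]
    mult.commute[of "a div n"] w_power_mult_order by simp

lemma lagrange_at_node:
  assumes "j < n"
  shows "poly (lagrange z j) (ys z a ^ (2 * l + 1))
    = (if a mod n = j then (\<Prod>i\<in>{..<n} - {j}. yv z j - yv z i) else 0)"
  unfolding ys_power lagrange_def poly_root_poly using mod_n_less[of a]
  by (auto intro!: prod_zero bexI[of _ "a mod n"])

lemma full_cross_product:
  "(\<Prod>b<l * n. X - ys z b) = (\<Prod>j<n. \<Prod>e<l. X - w ^ e * z (n + j))"
proof -
  have "(\<Prod>b<l * n. X - ys z b) = (\<Prod>e<l. \<Prod>j<n. X - w ^ e * z (n + j))"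
    unfolding ys_def string_def by (rule prod_pair_index)
  then show ?thesis by (simp only: prod.swap[of _ "{..<n}"])
qed

text \<open>
  The missing factors \<open>\<Prod>\<^sub>e (X - w\<^sup>e y\<^sub>i)\<close> that \<open>prod_roots_split\<close> asks for, over all \<open>i\<close>, make up the
  product over the whole \<open>y\<close>-string; it depends only on the row.
\<close>

lemma vanishing_column_cleared:
  assumes "b < l * n"
  shows "poly (vanishing z (l + b div n) (b mod n)) (string z a) *
      poly (lagrange z (b mod n)) (string z a ^ (2 * l + 1))
    = (\<Prod>c<l * n. string z a - ys z c) * cleared_entry z a b"
proof -
  let ?X = "string z a" and ?j = "b mod n"
  have "poly (lagrange z ?j) (?X ^ (2 * l + 1))
      = (\<Prod>i\<in>{..<n} - {?j}. (\<Prod>p\<le>l. ?X - w ^ (p + l) * z (n + i)) * (\<Prod>e<l. ?X - w ^ e * z (n + i)))"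
    unfolding prod_roots_split lagrange_def poly_root_poly yv_def ..
  moreover have "(\<Prod>c<l * n. ?X - ys z c) = (\<Prod>e<l. ?X - w ^ e * z (n + ?j)) *
      (\<Prod>i\<in>{..<n} - {?j}. \<Prod>e<l. ?X - w ^ e * z (n + i))"
    unfolding full_cross_product using mod_n_less by (intro prod.remove) auto
  ultimately show ?thesis
    by (simp add: vanishing_def poly_monom poly_root_poly cleared_entry_def prod.distrib mult_ac)
qed

text \<open>
  On the \<open>y\<close>-nodes the second half of the columns vanishes. The two diagonal blocks are elementary:
  on the \<open>y\<close>-nodes the first half is a constant matrix with scaled columns, and on the \<open>x\<close>-nodes the
  second half is the cleared matrix with scaled rows.
\<close>

lemma det_vanishing_blocks:
  "detf (l * n + l * n)
     (\<lambda>a b. poly (vanishing z (b div n) (b mod n)) (nodes z a) *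
        poly (lagrange z (b mod n)) (nodes z a ^ (2 * l + 1)))
   = root_det * y_weight z * lag_prod z ^ l * (cross z * cleared_det z)"
proof -
  let ?N = "l * n"
  define V where "V a b = poly (vanishing z (b div n) (b mod n)) (nodes z a) *
        poly (lagrange z (b mod n)) (nodes z a ^ (2 * l + 1))" for a b
  define D where "D j = (\<Prod>i\<in>{..<n} - {j}. yv z j - yv z i)" for j
  have "detf (?N + ?N) V = detf ?N V * detf ?N (\<lambda>a b. V (?N + a) (?N + b))"
  proof (rule detf_block_lower_triangular)
    fix a b assume ab: "a < ?N" "?N \<le> b" "b < ?N + ?N"
    have node: "nodes z a = ys z a" using ab by (simp add: nodes_def)
    have ge: "\<not> b div n < l" using ab(2) n_pos div_le_mono[of "l * n" b n] by simp
    show "V a b = 0"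
    proof (cases "a mod n = b mod n")
      case True
      have "(\<Prod>e<l. ys z a - w ^ e * z (n + b mod n)) = 0"
        using div_n_less[OF ab(1)] True
        by (intro prod_zero) (auto simp: ys_def string_def intro!: bexI[of _ "a div n"])
      then show ?thesis using ge by (simp add: V_def node vanishing_def poly_root_poly)
    next
      case False
      then show ?thesis unfolding V_def node lagrange_at_node[OF mod_n_less] by simp
    qed
  qed
  also have "detf ?N V = detf ?N (\<lambda>a b.
      (if a mod n = b mod n then w ^ ((a div n) * (b div n)) else 0) *
      (z (n + b mod n) ^ (b div n) * D (b mod n)))"
  proof (rule detf_cong)
    fix a b assume ab: "a < ?N" "b < ?N"
    have node: "nodes z a = ys z a" using ab by (simp add: nodes_def)
    show "V a b = (if a mod n = b mod n then w ^ ((a div n) * (b div n)) else 0) *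
      (z (n + b mod n) ^ (b div n) * D (b mod n))"
      using div_n_less[OF ab(2)] unfolding V_def node lagrange_at_node[OF mod_n_less] D_def[symmetric]
      by (auto simp: vanishing_def poly_monom ys_def string_def power_mult_distrib power_mult)
  qed
  also have "\<dots> = root_det * (\<Prod>b<?N. z (n + b mod n) ^ (b div n) * D (b mod n))"
    unfolding detf_scale_cols root_det_def ..
  also have "(\<Prod>b<?N. z (n + b mod n) ^ (b div n) * D (b mod n)) = y_weight z * lag_prod z ^ l"
    using prod_pair_index[of "\<lambda>_. D" n l] by (simp add: prod.distrib y_weight_def lag_prod_def D_def)
  also have "detf ?N (\<lambda>a b. V (?N + a) (?N + b))
      = detf ?N (\<lambda>a b. (\<Prod>c<?N. string z a - ys z c) * cleared_entry z a b)"
  proof (rule detf_cong)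
    fix a b assume ab: "a < ?N" "b < ?N"
    have "nodes z (?N + a) = string z a" by (simp add: nodes_def)
    moreover have "(?N + b) div n = l + b div n" "(?N + b) mod n = b mod n" using n_pos by simp_all
    ultimately show "V (?N + a) (?N + b) = (\<Prod>c<?N. string z a - ys z c) * cleared_entry z a b"
      unfolding V_def using vanishing_column_cleared[OF ab(2)] by simp
  qed
  also have "\<dots> = cross z * cleared_det z"
    unfolding detf_scale_rows cross_def cleared_det_def ..
  finally show ?thesis by (simp add: V_def mult_ac)
qed

lemma vander_nodes:
  "vander (l * n + l * n) (nodes z) = vander (l * n) (ys z) * (cross z * vander (l * n) (string z))"
proof -
  let ?N = "l * n"
  have split: "(\<Prod>i<?N + k. f i) = (\<Prod>i<?N. f i) * (\<Prod>i<k. f (?N + i))" for k and f :: "nat \<Rightarrow> complex"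
    by (induction k) (simp_all add: mult_ac)
  have "vander (?N + ?N) (nodes z) = (\<Prod>a<?N. \<Prod>i<a. nodes z a - nodes z i) *
      (\<Prod>a<?N. \<Prod>i<?N + a. nodes z (?N + a) - nodes z i)"
    unfolding vander_def by (rule split)
  also have "(\<Prod>a<?N. \<Prod>i<a. nodes z a - nodes z i) = vander ?N (ys z)"
    unfolding vander_def by (intro prod.cong refl) (auto simp: nodes_def)
  also have "(\<Prod>a<?N. \<Prod>i<?N + a. nodes z (?N + a) - nodes z i)
      = (\<Prod>a<?N. (\<Prod>b<?N. string z a - ys z b) * (\<Prod>i<a. string z a - string z i))"
    unfolding split by (intro prod.cong refl arg_cong2[where f = "(*)"]) (auto simp: nodes_def)
  finally show ?thesis by (simp add: prod.distrib cross_def vander_def)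
qed

definition swap_sign :: "nat \<Rightarrow> complex" where
  "swap_sign m = (\<Prod>a<m. \<Prod>i<a. -1)"

lemma swap_sign_square: "swap_sign m * swap_sign m = 1"
  unfolding swap_sign_def prod.distrib[symmetric] by simp

text \<open>
  Evaluation of the Lagrange polynomials at their own nodes gives a diagonal matrix.
\<close>

lemma lag_det_vander: "vander n (yv z) * lag_det z = lag_prod z"
proof -
  have "detf n (\<lambda>a j. poly (lagrange z j) (yv z a)) = detf n (\<lambda>a m. yv z a ^ m) * lag_det z"
    unfolding lag_det_def
    by (rule detf_mult, subst poly_eq_sum_lessThan[OF degree_lagrange]) (simp_all add: mult.commute)
  moreover have "detf n (\<lambda>a j. poly (lagrange z j) (yv z a)) = lag_prod z"
    unfolding lag_prod_def
    by (subst detf_upper_triangular)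
       (auto simp: lagrange_def poly_root_poly intro!: bexI)
  ultimately show ?thesis by (simp add: vander_eq_detf)
qed

lemma lag_prod_eq: "lag_prod z = swap_sign n * (vander n (yv z))\<^sup>2"
proof -
  have "lag_prod z = (\<Prod>j<n. (\<Prod>i<j. yv z j - yv z i) * (\<Prod>i\<in>{j<..<n}. yv z j - yv z i))"
    unfolding lag_prod_def
  proof (intro prod.cong refl)
    fix j assume "j \<in> {..<n}"
    then have split: "{..<n} - {j} = {..<j} \<union> {j<..<n}" by auto
    show "(\<Prod>i\<in>{..<n} - {j}. yv z j - yv z i)
        = (\<Prod>i<j. yv z j - yv z i) * (\<Prod>i\<in>{j<..<n}. yv z j - yv z i)"
      unfolding split by (rule prod.union_disjoint) auto
  qed
  also have "\<dots> = vander n (yv z) * (\<Prod>j<n. \<Prod>i\<in>{j<..<n}. yv z j - yv z i)"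
    by (simp add: prod.distrib vander_def)
  also have "(\<Prod>j<n. \<Prod>i\<in>{j<..<n}. yv z j - yv z i)
      = (\<Prod>j<n. \<Prod>i\<in>{i \<in> {..<n}. j < i}. yv z j - yv z i)"
    by (intro prod.cong refl) auto
  also have "\<dots> = (\<Prod>i<n. \<Prod>j\<in>{j \<in> {..<n}. j < i}. yv z j - yv z i)"
    by (rule prod.swap_restrict) simp_all
  also have "\<dots> = (\<Prod>i<n. \<Prod>j<i. yv z j - yv z i)"
    by (intro prod.cong refl) auto
  also have "\<dots> = vandermonde n (yv z)" by (simp add: vandermonde_def)
  finally show ?thesis
    unfolding vandermonde_eq_vander swap_sign_def power2_eq_square by (simp only: mult_ac)
qed

text \<open>
  The alternant is computed in two ways. The factor \<open>cross\<close> appears on both sides, and a power of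
  \<open>vander n (yv z)\<close> is multiplied in to turn \<open>lag_det\<close> into \<open>lag_prod\<close>; since \<open>cross\<close> and \<open>lag_prod\<close>
  may vanish at points of interest, they are cancelled afterwards, as polynomials.
\<close>

lemma schur_determinant_identity_cross:
  "(vander (l * n) (ys z) * vander (l * n) (string z) * schur z
     - swap_sign n ^ l * root_det * y_weight z * cleared_det z)
   * (cross z * lag_prod z ^ (2 * l)) = 0"
proof -
  let ?d = "vander n (yv z)"
  have "vander (l * n + l * n) (nodes z) * schur z * lag_det z ^ (2 * l)
      = root_det * y_weight z * lag_prod z ^ l * (cross z * cleared_det z)"
    using det_vanishing_blocks[of z] det_vanishing_columns[of z "nodes z"]
      det_lagrange_columns[of "nodes z" z]
    by (simp add: alternant_factorization schur_def)
  then have 1: "vander (l * n + l * n) (nodes z) * schur z * lag_det z ^ (2 * l) * ?d ^ (2 * l)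
      = root_det * y_weight z * lag_prod z ^ l * (cross z * cleared_det z) * ?d ^ (2 * l)"
    by simp
  have 2: "lag_det z ^ (2 * l) * ?d ^ (2 * l) = lag_prod z ^ (2 * l)"
    unfolding power_mult_distrib[symmetric] using lag_det_vander[of z] by (simp add: mult.commute)
  have "?d\<^sup>2 = swap_sign n * lag_prod z"
    unfolding lag_prod_eq mult.assoc[symmetric] swap_sign_square by simp
  then have 3: "?d ^ (2 * l) = swap_sign n ^ l * lag_prod z ^ l"
    by (simp add: power_mult power_mult_distrib)
  have 4: "lag_prod z ^ l * lag_prod z ^ l = lag_prod z ^ (2 * l)"
    by (simp add: power_add[symmetric] mult_2)
  have "vander (l * n + l * n) (nodes z) * schur z * lag_prod z ^ (2 * l)
      = vander (l * n + l * n) (nodes z) * schur z * lag_det z ^ (2 * l) * ?d ^ (2 * l)"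
    by (simp only: 2[symmetric] mult.assoc)
  also note 1
  also have "root_det * y_weight z * lag_prod z ^ l * (cross z * cleared_det z) * ?d ^ (2 * l)
      = root_det * y_weight z * (cross z * cleared_det z) * swap_sign n ^ l * (lag_prod z ^ l * lag_prod z ^ l)"
    unfolding 3 by (simp only: mult_ac)
  also note 4
  finally have "vander (l * n + l * n) (nodes z) * schur z * lag_prod z ^ (2 * l)
      = root_det * y_weight z * (cross z * cleared_det z) * swap_sign n ^ l * lag_prod z ^ (2 * l)" .
  then show ?thesis unfolding vander_nodes by (simp add: algebra_simps)
qed

section \<open>Cancellation at a generic point\<close>

lemma string_inj:
  assumes inj: "inj_on (\<lambda>j. norm (u j)) {..<n}" and nz: "\<And>j. j < n \<Longrightarrow> u j \<noteq> 0"
  shows "inj_on (string u) {..<l * n}"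
proof (rule inj_onI)
  fix a b assume ab: "a \<in> {..<l * n}" "b \<in> {..<l * n}" "string u a = string u b"
  have "norm (u (a mod n)) = norm (u (b mod n))"
    using arg_cong[OF ab(3), of norm] by (simp add: string_def norm_mult norm_power norm_w)
  then have m: "a mod n = b mod n"
    using inj mod_n_less by (auto dest: inj_onD)
  then have "w ^ (a div n) = w ^ (b div n)"
    using ab(3) nz[OF mod_n_less[of b]] by (simp add: string_def)
  moreover have "a div n < l" "b div n < l" using ab div_n_less by auto
  ultimately have "a div n = b div n"
    using inj_onD[OF w_inj, of "a div n" "b div n"] by simp
  then show "a = b" using m by (metis div_mult_mod_eq)
qed

text \<open>
  A point whose coordinates have distinct absolute values: since \<open>w\<close> has absolute value 1, none of
  the factors in question vanishes there.
\<close>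

definition base_point :: "nat \<Rightarrow> complex" where
  "base_point i = of_nat (Suc i)"

lemma norm_base_point: "norm (base_point i) = real (Suc i)"
  unfolding base_point_def by (rule norm_of_nat)

lemma base_point_strings_inj:
  "inj_on (string base_point) {..<l * n}" "inj_on (ys base_point) {..<l * n}"
proof -
  have "base_point j \<noteq> 0" for j using norm_base_point[of j] by auto
  then show "inj_on (string base_point) {..<l * n}" "inj_on (ys base_point) {..<l * n}"
    unfolding ys_def by (intro string_inj; simp add: inj_on_def norm_base_point)+
qed

lemma base_point_ne: "norm c = 1 \<Longrightarrow> norm d = 1 \<Longrightarrow> i \<noteq> j \<Longrightarrow> c * base_point i - d * base_point j \<noteq> 0"
proof
  assume *: "norm c = 1" "norm d = 1" "i \<noteq> j" "c * base_point i - d * base_point j = 0"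
  then have "norm (c * base_point i) = norm (d * base_point j)" by simp
  then show False using * by (simp add: norm_mult norm_base_point)
qed

lemma cross_base_point: "cross base_point \<noteq> 0"
proof -
  have "string base_point a - ys base_point b \<noteq> 0" for a b
    unfolding string_def ys_def using mod_n_less[of a] by (intro base_point_ne) (simp_all add: norm_power norm_w)
  then show ?thesis unfolding cross_def by simp
qed

lemma lag_prod_base_point: "lag_prod base_point \<noteq> 0"
proof -
  have "yv base_point i \<noteq> yv base_point j" if "i \<noteq> j" for i j
  proof
    assume "yv base_point i = yv base_point j"
    then have "norm (yv base_point i) = norm (yv base_point j)" by simp
    then have "real (Suc (n + i)) ^ (2 * l + 1) = real (Suc (n + j)) ^ (2 * l + 1)"
      by (simp only: yv_def norm_power norm_base_point)
    then have "real (Suc (n + i)) = real (Suc (n + j))"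
      by (rule power_eq_imp_eq_base) simp_all
    then show False using that by simp
  qed
  then show ?thesis unfolding lag_prod_def by auto
qed

lemma polynomial_fun_vander:
  assumes "\<And>a. polynomial_fun m (\<lambda>z. Z z a)"
  shows "polynomial_fun m (\<lambda>z. vander M (Z z))"
  unfolding vander_def by (intro polynomial_fun_prod polynomial_fun_diff assms)

lemma polynomial_fun_y: "j < n \<Longrightarrow> polynomial_fun (2 * n) (\<lambda>z. z (n + j))"
  by (rule polynomial_fun_var) simp

lemma polynomial_fun_cleared_det: "polynomial_fun (2 * n) cleared_det"
  unfolding cleared_det_def[abs_def] cleared_entry_def[abs_def]
  by (intro polynomial_fun_detf polynomial_fun_mult polynomial_fun_prod polynomial_fun_diff
      polynomial_fun_power polynomial_fun_xs polynomial_fun_const polynomial_fun_y) simp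

lemma polynomial_fun_y_weight: "polynomial_fun (2 * n) y_weight"
  unfolding y_weight_def[abs_def]
  by (intro polynomial_fun_prod polynomial_fun_power polynomial_fun_y mod_n_less)

lemma polynomial_fun_cross: "polynomial_fun (2 * n) cross"
  unfolding cross_def[abs_def]
  by (intro polynomial_fun_prod polynomial_fun_diff polynomial_fun_xs polynomial_fun_ys)

lemma polynomial_fun_lag_prod: "polynomial_fun (2 * n) lag_prod"
  unfolding lag_prod_def[abs_def] yv_def
  by (intro polynomial_fun_prod polynomial_fun_diff polynomial_fun_power polynomial_fun_y) simp_all

lemma schur_determinant_identity:
  "vander (l * n) (ys z) * vander (l * n) (string z) * schur z
     = swap_sign n ^ l * root_det * y_weight z * cleared_det z"
proof -
  have "vander (l * n) (ys z) * vander (l * n) (string z) * schur z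
     - swap_sign n ^ l * root_det * y_weight z * cleared_det z = 0"
  proof (rule polynomial_fun_cancel[OF _ _ schur_determinant_identity_cross])
    show "polynomial_fun (2 * n) (\<lambda>z. vander (l * n) (ys z) * vander (l * n) (string z) * schur z
        - swap_sign n ^ l * root_det * y_weight z * cleared_det z)"
      by (intro polynomial_fun_diff polynomial_fun_mult polynomial_fun_const polynomial_fun_vander
          polynomial_fun_xs polynomial_fun_ys polynomial_fun_schur polynomial_fun_y_weight
          polynomial_fun_cleared_det)
    show "polynomial_fun (2 * n) (\<lambda>z. cross z * lag_prod z ^ (2 * l))"
      by (intro polynomial_fun_mult polynomial_fun_power polynomial_fun_cross polynomial_fun_lag_prod)
    show "cross base_point * lag_prod base_point ^ (2 * l) \<noteq> 0"
      using cross_base_point lag_prod_base_point by simp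
  qed
  then show ?thesis by simp
qed

text \<open>
  In the transposed order of the indices this is a block diagonal matrix, and each block is a
  Vandermonde matrix at the distinct points \<open>w\<^sup>k\<close>.
\<close>

lemma root_det_nonzero: "root_det \<noteq> 0"
proof -
  define \<pi> where "\<pi> a = (a mod n) * l + a div n" for a
  define F where "F a b = (if a div l = b div l then w ^ ((a mod l) * (b mod l)) else 0)" for a b
  have bij: "bij_betw \<pi> {..<l * n} {..<l * n}"
    unfolding \<pi>_def using bij_betw_swap_index[of id l n] by simp
  have \<pi>: "\<pi> a div l = a mod n" "\<pi> a mod l = a div n" if "a < l * n" for a
    using div_n_less[OF that] l_pos by (simp_all add: \<pi>_def)
  have "root_det = detf (l * n) (\<lambda>a b. F (\<pi> a) (\<pi> b))"
    unfolding root_det_def by (rule detf_cong) (simp add: F_def \<pi>)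
  also have "\<dots> = detf (n * l) F"
    unfolding detf_permute_both[OF bij] by (simp add: mult.commute)
  also have "\<dots> = detf l (\<lambda>a b. (w ^ a) ^ b) ^ n"
    unfolding F_def using detf_block_diagonal[of n l "\<lambda>_ a b. w ^ (a * b)"] by (simp add: power_mult)
  finally show ?thesis using vander_roots_nonzero by (simp add: vander_eq_detf)
qed

section \<open>The partition function as a Schur polynomial\<close>

lemma vandermonde_q_string:
  obtains s :: complex where "s * s = 1"
    "\<And>u. vandermonde (l * n) (q_string l q u) = s * vander (l * n) (string u)"
proof -
  define \<pi> where "\<pi> a = (a mod n) * l + a div n" for a
  have bij: "bij_betw \<pi> {..<l * n} {..<l * n}"
    unfolding \<pi>_def using bij_betw_swap_index[of id l n] by simp
  obtain s where s: "s * s = 1" "\<And>f. detf (l * n) (\<lambda>a b. f (\<pi> a) b) = s * detf (l * n) f"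
    using detf_permute_rows[OF bij] by blast
  have "vandermonde (l * n) (q_string l q u) = (swap_sign (l * n) * s) * vander (l * n) (string u)" for u
  proof -
    have "q_string l q u (\<pi> a) = string u a" if "a < l * n" for a
      using div_n_less[OF that] l_pos
      by (simp add: q_string_def string_def \<pi>_def w_def power_mult)
    then have "detf (l * n) (\<lambda>a b. string u a ^ b)
        = detf (l * n) (\<lambda>a b. q_string l q u (\<pi> a) ^ b)"
      by (intro detf_cong) simp
    also have "\<dots> = s * detf (l * n) (\<lambda>a b. q_string l q u a ^ b)"
      by (rule s(2)[of "\<lambda>a b. q_string l q u a ^ b"])
    finally have "vander (l * n) (string u) = s * vander (l * n) (q_string l q u)"
      by (simp only: vander_eq_detf)
    then have "s * vander (l * n) (string u) = vander (l * n) (q_string l q u)"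
      using s(1) by (simp add: mult.assoc[symmetric])
    then show ?thesis by (simp add: vandermonde_eq_vander swap_sign_def mult_ac)
  qed
  moreover have "(swap_sign (l * n) * s) * (swap_sign (l * n) * s) = 1"
    using s(1) swap_sign_square[of "l * n"] by (metis mult.assoc mult.left_commute mult_1_right)
  ultimately show ?thesis by (rule that[rotated])
qed

text \<open>
  In \<open>A_block\<close> the row index belongs to the power of \<open>q\<close> at \<open>y\<close> and the column index to the one at
  \<open>x\<close>, although the block row belongs to an \<open>x\<close>-variable and the block column to a \<open>y\<close>-variable.
  Reversing the order within the blocks, for rows and columns alike, exchanges the two roles up to
  factors that depend on the row or the column only. The result is the matrix of the \<open>1 / denom z a b\<close>,
  with row \<open>a\<close> a point of an \<open>x\<close>-string and column \<open>b\<close> a point of a \<open>y\<close>-string.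
\<close>

definition denom :: "(nat \<Rightarrow> complex) \<Rightarrow> nat \<Rightarrow> nat \<Rightarrow> complex" where
  "denom z a b = (string z a - w ^ (b div n + l) * z (n + b mod n)) *
     (string z a - w ^ (Suc (b div n) + l) * z (n + b mod n))"

lemma block_denom_reversed:
  assumes "i < l" "j < l"
  shows "block_denom q x y (l - Suc i) (l - Suc j)
    = (w ^ (l - Suc j) / w ^ i)\<^sup>2 * ((w ^ i * x - w ^ (j + l) * y) * (w ^ i * x - w ^ (Suc j + l) * y))"
proof -
  let ?c = "w ^ (l - Suc j) / w ^ i"
  have 1: "q ^ (2 * (l - Suc j)) = ?c * w ^ i"
    using w_nonzero by (simp add: w_def power_mult)
  have 2: "w ^ (l - Suc i + l) = ?c * w ^ (j + l)"
  proof -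
    have "w ^ (l - Suc i + l) * w ^ i = w ^ (l - Suc j) * w ^ (j + l)"
      unfolding power_add[symmetric] using assms by simp
    then show ?thesis using w_nonzero by (simp add: field_simps)
  qed
  have 3: "w ^ (Suc (l - Suc i) + l) = ?c * w ^ (Suc j + l)"
    using 2 by simp
  show ?thesis
    unfolding block_denom_def q_powi_minus q_powi_plus 1 2 3 by (simp add: algebra_simps power2_eq_square)
qed

definition reversed_index :: "nat \<Rightarrow> nat" where
  "reversed_index a = (a mod n) * l + (l - Suc (a div n))"

lemma bij_betw_reversed_index: "bij_betw reversed_index {..<l * n} {..<l * n}"
proof -
  have "bij_betw (\<lambda>i. l - Suc i) {..<l} {..<l}"
    by (rule bij_betwI[where g = "\<lambda>i. l - Suc i"]) auto
  from bij_betw_swap_index[OF this] show ?thesis unfolding reversed_index_def[abs_def] .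
qed

lemma reversed_index_div_mod:
  "reversed_index a div l = a mod n" "reversed_index a mod l = l - Suc (a div n)"
  using l_pos by (simp_all add: reversed_index_def)

lemma block_denom_at_reversed_index:
  assumes "a < l * n" "b < l * n"
  shows "block_denom q (z (a mod n)) (z (n + b mod n)) (l - Suc (a div n)) (l - Suc (b div n))
    = (w ^ (l - Suc (b div n)) / w ^ (a div n))\<^sup>2 * denom z a b"
  unfolding block_denom_reversed[OF div_n_less[OF assms(1)] div_n_less[OF assms(2)]]
  by (simp add: denom_def string_def)

lemma det_A_matrix:
  obtains c where "\<And>z. det (A_matrix n l q z (\<lambda>j. z (n + j))) = c * detf (l * n) (\<lambda>a b. 1 / denom z a b)"
proof -
  let ?N = "l * n"
  define r where "r a = (w ^ (a div n))\<^sup>2" for a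
  define s where "s b = 1 / (w ^ (l - Suc (b div n)))\<^sup>2" for b
  have "det (A_matrix n l q z (\<lambda>j. z (n + j))) =
    (\<Prod>a<?N. r a) * (\<Prod>b<?N. s b) * detf ?N (\<lambda>a b. 1 / denom z a b)" for z
  proof -
    define A where "A a b = 1 / block_denom q (z (a div l)) (z (n + b div l)) (a mod l) (b mod l)" for a b
    have "det (A_matrix n l q z (\<lambda>j. z (n + j))) = detf ?N A"
      unfolding detf_def A_matrix_def A_def A_block_def using l_pos
      by (intro arg_cong[where f = det] eq_matI) auto
    also have "\<dots> = detf ?N (\<lambda>a b. A (reversed_index a) (reversed_index b))"
      by (rule detf_permute_both[OF bij_betw_reversed_index, symmetric])
    also have "\<dots> = detf ?N (\<lambda>a b. r a * ((1 / denom z a b) * s b))"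
    proof (rule detf_cong)
      fix a b assume "a < ?N" "b < ?N"
      then show "A (reversed_index a) (reversed_index b) = r a * ((1 / denom z a b) * s b)"
        using w_nonzero
        by (simp add: A_def reversed_index_div_mod block_denom_at_reversed_index r_def s_def power_divide)
    qed
    also have "\<dots> = (\<Prod>a<?N. r a) * (detf ?N (\<lambda>a b. 1 / denom z a b) * (\<Prod>b<?N. s b))"
      unfolding detf_scale_rows detf_scale_cols ..
    finally show ?thesis by (simp add: mult_ac)
  qed
  then show ?thesis by (rule that)
qed

definition row_prod :: "(nat \<Rightarrow> complex) \<Rightarrow> nat \<Rightarrow> complex" where
  "row_prod z a = (\<Prod>j<n. \<Prod>p\<le>l. string z a - w ^ (p + l) * z (n + j))"

lemma prefactor_eq:
  "(\<Prod>i<n. \<Prod>j<n. \<Prod>p\<le>l. \<Prod>k<l. q ^ (2 * k) * z i - q powi (2 * int p - 1) * z (n + j))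
    = (\<Prod>a<l * n. row_prod z a)"
proof -
  have "(\<Prod>a<l * n. row_prod z a)
      = (\<Prod>k<l. \<Prod>i<n. \<Prod>j<n. \<Prod>p\<le>l. w ^ k * z i - w ^ (p + l) * z (n + j))"
    unfolding row_prod_def string_def
    by (rule prod_pair_index[of "\<lambda>k i. \<Prod>j<n. \<Prod>p\<le>l. w ^ k * z i - w ^ (p + l) * z (n + j)"])
  also have "\<dots> = (\<Prod>i<n. \<Prod>j<n. \<Prod>p\<le>l. \<Prod>k<l. w ^ k * z i - w ^ (p + l) * z (n + j))"
    by (subst prod.swap, rule prod.cong[OF refl], subst prod.swap, rule prod.cong[OF refl], rule prod.swap)
  finally show ?thesis by (simp add: q_powi_minus w_def power_mult)
qed

text \<open>
  Multiplied by the common denominator of its row, an entry becomes a polynomial of degree less than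
  \<open>l\<close> in the \<open>x\<close>-point, times a product that depends on the \<open>x\<close>-point and on the number \<open>j\<close> of
  the \<open>y\<close>-variable only. Its expansion in powers factors off a matrix that is constant up to powers of the \<open>y\<^sub>j\<close> in its rows.
\<close>

lemma det_cleared:
  obtains c where "\<And>z. (\<And>a b. a < l * n \<Longrightarrow> b < l * n \<Longrightarrow> denom z a b \<noteq> 0) \<Longrightarrow>
    (\<Prod>a<l * n. row_prod z a) * detf (l * n) (\<lambda>a b. 1 / denom z a b) = c * y_weight z * cleared_det z"
proof -
  let ?N = "l * n"
  \<comment> \<open>the factors of the common denominator that column \<open>i\<close> of a block lacks\<close>
  define S where "S i = {..l} - {i, Suc i}" for i
  define T where "T c b = (if c mod n = b mod n
    then coeff (root_poly (\<lambda>p. w ^ (p + l)) (S (b div n))) (c div n) else 0)" for c b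
  have card: "Suc (card (S i)) = l" if "i < l" for i
  proof -
    have "card (S i) = card {..l} - card {i, Suc i}"
      unfolding S_def using that by (intro card_Diff_subset) auto
    then show ?thesis using l_pos by simp
  qed
  have "(\<Prod>a<?N. row_prod z a) * detf ?N (\<lambda>a b. 1 / denom z a b) = detf ?N T * y_weight z * cleared_det z"
    if denom: "\<And>a b. a < ?N \<Longrightarrow> b < ?N \<Longrightarrow> denom z a b \<noteq> 0" for z
  proof -
    have "detf ?N (\<lambda>a b. row_prod z a * (1 / denom z a b))
        = detf ?N (cleared_entry z) * detf ?N (\<lambda>c b. z (n + c mod n) ^ (l - Suc (c div n)) * T c b)"
    proof (rule detf_mult)
      fix a b assume ab: "a < ?N" "b < ?N"
      let ?X = "string z a" and ?y = "z (n + b mod n)"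
      let ?S = "S (b div n)"
      define Q where "Q j = (\<Prod>i\<in>{..<n} - {j}. \<Prod>p\<le>l. ?X - w ^ (p + l) * z (n + i))" for j
      define t where "t k = coeff (root_poly (\<lambda>p. w ^ (p + l)) ?S) k" for k
      have b: "b div n < l" using div_n_less[OF ab(2)] .
      have "(\<Prod>p\<le>l. ?X - w ^ (p + l) * ?y) = denom z a b * (\<Prod>p\<in>?S. ?X - w ^ (p + l) * ?y)"
      proof -
        have "{..l} = insert (b div n) (insert (Suc (b div n)) ?S)" using b by (auto simp: S_def)
        moreover have "b div n \<notin> insert (Suc (b div n)) ?S" "Suc (b div n) \<notin> ?S" "finite ?S"
          by (auto simp: S_def)
        ultimately show ?thesis by (simp add: denom_def mult.assoc)
      qed
      then have "row_prod z a = denom z a b * (\<Prod>p\<in>?S. ?X - w ^ (p + l) * ?y) * Q (b mod n)"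
        unfolding row_prod_def Q_def using mod_n_less[of b] by (subst prod.remove[of _ "b mod n"]) auto
      then have "row_prod z a * (1 / denom z a b) = (\<Prod>p\<in>?S. ?X - w ^ (p + l) * ?y) * Q (b mod n)"
        using denom[OF ab] by simp
      also have "(\<Prod>p\<in>?S. ?X - w ^ (p + l) * ?y) = (\<Sum>k<l. ?X ^ k * ?y ^ (l - Suc k) * t k)"
      proof -
        have "card ?S - k = l - Suc k" for k using card[OF b] by linarith
        then show ?thesis
          using homogeneous_root_product[of ?S ?X "\<lambda>p. w ^ (p + l)" ?y]
          unfolding card[OF b] t_def by (simp add: S_def)
      qed
      also have "\<dots> * Q (b mod n) = (\<Sum>k<l. ?X ^ k * Q (b mod n) * (?y ^ (l - Suc k) * t k))"
        by (simp add: sum_distrib_left sum_distrib_right mult_ac)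
      also have "\<dots> = (\<Sum>k<l. \<Sum>j<n. if j = b mod n
          then ?X ^ k * Q j * (z (n + j) ^ (l - Suc k) * t k) else 0)"
        using mod_n_less[of b] by (subst sum.delta) auto
      also have "\<dots> = (\<Sum>c<?N. if c mod n = b mod n
          then ?X ^ (c div n) * Q (c mod n) * (z (n + c mod n) ^ (l - Suc (c div n)) * t (c div n)) else 0)"
        by (rule sum_pair_index[symmetric])
      also have "\<dots> = (\<Sum>c<?N. cleared_entry z a c * (z (n + c mod n) ^ (l - Suc (c div n)) * T c b))"
        by (intro sum.cong refl) (simp add: cleared_entry_def Q_def T_def t_def)
      finally show "row_prod z a * (1 / denom z a b)
        = (\<Sum>c<?N. cleared_entry z a c * (z (n + c mod n) ^ (l - Suc (c div n)) * T c b))" .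
    qed
    moreover have "(\<Prod>c<?N. z (n + c mod n) ^ (l - Suc (c div n))) = y_weight z"
    proof -
      have "(\<Prod>c<?N. z (n + c mod n) ^ (l - Suc (c div n))) = (\<Prod>k<l. \<Prod>j<n. z (n + j) ^ (l - Suc k))"
        by (rule prod_pair_index[of "\<lambda>k j. z (n + j) ^ (l - Suc k)"])
      also have "\<dots> = (\<Prod>k<l. \<Prod>j<n. z (n + j) ^ k)"
        by (rule prod.nat_diff_reindex[of "\<lambda>k. \<Prod>j<n. z (n + j) ^ k"])
      also have "\<dots> = y_weight z"
        unfolding y_weight_def by (rule prod_pair_index[symmetric])
      finally show ?thesis .
    qed
    ultimately show ?thesis
      unfolding detf_scale_rows cleared_det_def by (simp add: mult_ac)
  qed
  then show ?thesis by (rule that)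
qed

lemma partition_formula_eq_schur:
  obtains c where "\<And>z. partition_regular n l q z (\<lambda>j. z (n + j)) \<Longrightarrow>
    partition_formula n l q z (\<lambda>j. z (n + j)) = c * schur z"
proof -
  obtain s where s: "s * s = 1"
    "\<And>u. vandermonde (l * n) (q_string l q u) = s * vander (l * n) (string u)"
    using vandermonde_q_string by blast
  obtain cA where cA:
    "\<And>z. det (A_matrix n l q z (\<lambda>j. z (n + j))) = cA * detf (l * n) (\<lambda>a b. 1 / denom z a b)"
    using det_A_matrix by blast
  obtain cT where cT: "\<And>z. (\<And>a b. a < l * n \<Longrightarrow> b < l * n \<Longrightarrow> denom z a b \<noteq> 0) \<Longrightarrow>
    (\<Prod>a<l * n. row_prod z a) * detf (l * n) (\<lambda>a b. 1 / denom z a b) = cT * y_weight z * cleared_det z"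
    using det_cleared by blast
  define e where "e = swap_sign n ^ l * root_det"
  have e: "e \<noteq> 0"
    using swap_sign_square[of n] root_det_nonzero by (auto simp: e_def)
  have "partition_formula n l q z (\<lambda>j. z (n + j)) = (cA * cT / e) * schur z"
    if reg: "partition_regular n l q z (\<lambda>j. z (n + j))" for z
  proof -
    define V where "V = vander (l * n) (ys z) * vander (l * n) (string z)"
    have VV: "vandermonde (l * n) (q_string l q z) *
        vandermonde (l * n) (q_string l q (\<lambda>j. z (n + j))) = V"
      using s(1) unfolding s(2) V_def ys_def by (metis mult.assoc mult.commute mult_1)
    have V: "V \<noteq> 0" using reg unfolding partition_regular_def VV[symmetric] by simp
    have denom: "denom z a b \<noteq> 0" if "a < l * n" "b < l * n" for a b
    proof -
      have "block_denom q (z (a mod n)) (z (n + b mod n)) (l - Suc (a div n)) (l - Suc (b div n)) \<noteq> 0"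
        using reg l_pos mod_n_less unfolding partition_regular_def by simp
      then show ?thesis unfolding block_denom_at_reversed_index[OF that] by simp
    qed
    have "partition_formula n l q z (\<lambda>j. z (n + j))
        = cA * ((\<Prod>a<l * n. row_prod z a) * detf (l * n) (\<lambda>a b. 1 / denom z a b)) / V"
      unfolding partition_formula_def VV prefactor_eq cA by simp
    also have "\<dots> = cA * (cT * y_weight z * cleared_det z) / V"
      by (subst cT) (use denom in auto)
    also have "\<dots> = (cA * cT / e) * (e * y_weight z * cleared_det z) / V"
      using e by simp
    also have "e * y_weight z * cleared_det z = V * schur z"
      unfolding e_def V_def schur_determinant_identity by (simp add: mult_ac)
    finally show ?thesis using V by simp
  qed
  then show ?thesis by (rule that)
qed

text \<open>
  The product of all the denominators is itself a polynomial, nonzero at \<open>base_point\<close>, so it can be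
  cancelled.
\<close>

lemma polynomial_fun_eqI:
  assumes f: "polynomial_fun (2 * n) f" and g: "polynomial_fun (2 * n) g"
    and eq: "\<And>z. partition_regular n l q z (\<lambda>j. z (n + j)) \<Longrightarrow> f z = g z"
  shows "f = g"
proof
  fix z
  define R where "R z = vandermonde (l * n) (q_string l q z) *
      vandermonde (l * n) (q_string l q (\<lambda>j. z (n + j))) *
      (\<Prod>\<alpha><n. \<Prod>\<beta><n. \<Prod>i<l. \<Prod>j<l. block_denom q (z \<alpha>) (z (n + \<beta>)) i j)" for z
  have R_iff: "R z \<noteq> 0 \<longleftrightarrow> partition_regular n l q z (\<lambda>j. z (n + j))" for z
    unfolding R_def partition_regular_def by auto
  obtain s where s: "s * s = 1"
    "\<And>u. vandermonde (l * n) (q_string l q u) = s * vander (l * n) (string u)"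
    using vandermonde_q_string by blast
  have "polynomial_fun (2 * n) R"
    unfolding R_def[abs_def] block_denom_def s(2) ys_def[symmetric]
    by (intro polynomial_fun_mult polynomial_fun_prod polynomial_fun_diff polynomial_fun_const
        polynomial_fun_vander polynomial_fun_xs polynomial_fun_ys polynomial_fun_y polynomial_fun_var)
       auto
  moreover have "R base_point \<noteq> 0"
  proof -
    have "vander (l * n) (string base_point) \<noteq> 0" "vander (l * n) (ys base_point) \<noteq> 0"
      using base_point_strings_inj vander_nonzero by auto
    moreover have "s \<noteq> 0" using s(1) by auto
    moreover have "block_denom q (base_point \<alpha>) (base_point (n + \<beta>)) i j \<noteq> 0" if "\<alpha> < n" for \<alpha> \<beta> i j
    proof -
      have "q ^ (2 * j) = w ^ j" by (simp add: w_def power_mult)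
      moreover have "w ^ j * base_point \<alpha> - w ^ m * base_point (n + \<beta>) \<noteq> 0" for m
        using that by (intro base_point_ne) (simp_all add: norm_power norm_w)
      ultimately show ?thesis unfolding block_denom_def q_powi_minus q_powi_plus
        by (simp del: power_Suc add_Suc)
    qed
    ultimately show ?thesis unfolding R_def s(2) ys_def[symmetric] by simp
  qed
  moreover have "(f z - g z) * R z = 0" for z
    using eq[of z] R_iff[of z] by auto
  ultimately have "f z - g z = 0"
    using polynomial_fun_cancel[OF polynomial_fun_diff[OF f g]] by blast
  then show "f z = g z" by simp
qed

lemma partition_function_eq_schur:
  obtains c where "partition_function n l q = (\<lambda>z. c * schur z)"
proof -
  obtain c where c: "\<And>z. partition_regular n l q z (\<lambda>j. z (n + j)) \<Longrightarrow>
    partition_formula n l q z (\<lambda>j. z (n + j)) = c * schur z"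
    using partition_formula_eq_schur by blast
  have poly: "polynomial_fun (2 * n) (\<lambda>z. c * schur z)"
    by (intro polynomial_fun_mult polynomial_fun_const polynomial_fun_schur)
  have "partition_function n l q = (\<lambda>z. c * schur z)"
    unfolding partition_function_def
  proof (rule the_equality)
    show "polynomial_fun (2 * n) (\<lambda>z. c * schur z) \<and>
      (\<forall>z. partition_regular n l q z (\<lambda>j. z (n + j)) \<longrightarrow>
        c * schur z = partition_formula n l q z (\<lambda>j. z (n + j)))"
      using poly c by simp
    fix f assume f: "polynomial_fun (2 * n) f \<and>
      (\<forall>z. partition_regular n l q z (\<lambda>j. z (n + j)) \<longrightarrow>
        f z = partition_formula n l q z (\<lambda>j. z (n + j)))"
    show "f = (\<lambda>z. c * schur z)"
      by (rule polynomial_fun_eqI) (use f poly c in auto)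
  qed
  then show ?thesis by (rule that)
qed

end

section \<open>The wheel condition\<close>

theorem theorem4p9:
  fixes n l :: nat
  assumes "n \<ge> 1" and "l \<ge> 1"
  shows "wheel_condition (2 * n) l 2 ((rho l)\<^sup>2) (rho l) (partition_function n l (rho l))"
proof -
  interpret odd_primitive_root l "rho l"
    by (rule odd_primitive_root_rho) (rule assms)
  interpret partition_nodes l "rho l" n
    by unfold_locales (rule assms)
  obtain c where c: "partition_function n l (rho l) = (\<lambda>z. c * schur z)"
    by (rule partition_function_eq_schur)
  have "((rho l)\<^sup>2) powi (int l - 1) * rho l ^ (2 + 1) = 1"
  proof -
    have "((rho l)\<^sup>2) powi (int l - 1) = ((rho l)\<^sup>2) ^ (l - 1)"
      using assms(2) by (simp add: power_int_def nat_diff_distrib)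
    moreover have "2 * (l - 1) + (2 + 1) = 2 * l + 1" using assms(2) by simp
    then have "((rho l)\<^sup>2) ^ (l - 1) * rho l ^ (2 + 1) = rho l ^ (2 * l + 1)"
      unfolding power_mult[symmetric] power_add[symmetric] by (simp only:)
    ultimately show ?thesis using q_power_order by (simp only:)
  qed
  moreover have "schur z = 0"
    if i: "\<forall>\<alpha>\<le>2. i \<alpha> < 2 * n" and s: "int (\<Sum>\<alpha><2. s \<alpha>) \<le> int l - 1"
      and z: "\<forall>\<alpha><2. z (i (\<alpha> + 1)) / z (i \<alpha>) = rho l * ((rho l)\<^sup>2) ^ s \<alpha>"
    for z :: "nat \<Rightarrow> complex" and i s :: "nat \<Rightarrow> nat"
  proof -
    have z0: "z (i 1) / z (i 0) = rho l * w ^ s 0" and z1: "z (i 2) / z (i 1) = rho l * w ^ s 1"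
      using z[rule_format, of 0] z[rule_format, of 1] by (simp_all add: w_def numeral_2_eq_2)
    have "rho l * w ^ s 0 \<noteq> 0" "rho l * w ^ s 1 \<noteq> 0"
      using q_nonzero w_nonzero by simp_all
    then have nz: "z (i 0) \<noteq> 0" "z (i 1) \<noteq> 0" using z0 z1 by auto
    have "int (s 0) + int (s 1) \<le> int l - 1" using s by (simp add: numeral_2_eq_2)
    then have "s 0 + s 1 \<le> l - 1" by linarith
    then show ?thesis
      by (rule schur_wheel[of "i 0" "i 1" "i 2", rotated 3])
         (use i nz z0 z1 in \<open>auto simp: divide_eq_eq\<close>)
  qed
  ultimately show ?thesis
    unfolding wheel_condition_def c by auto
qed

end
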